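(* Let $X$ be a separable Banach space such that $X^{**}$ is non-separable, $\ell_1$ does not isomorphically embed into $X$, and no spreading model generated by a normalized weakly null sequence in $X$ is equivalent to the unit vector basis of $\ell_1$. If $X$ coarsely embeds into a Banach space $Y$, then there exists $k\in\mathbb{N}$ such that the iterated dual $Y^{(2k)}$ of order $2k$ is non-separable.
   Context: A map $f:X\to Y$ is a coarse embedding if there are non-decreasing $\rho,\omega:[0,\infty)\to[0,\infty)$ with $\lim_{t\to\infty}\rho(t)=\infty$ and $\rho(\|x-y\|)\le\|f(x)-f(y)\|\le\omega(\|x-y\|)$. A sequence $(x_n)$ in $X$ generates a spreading model $(e_j)$ if for every $k$ and scalars $a_1,\dots,a_k$, $\lim_{n_1\to\infty}\cdots\lim_{n_k\to\infty}$ with $n_1<\dots<n_k$ of $\|\sum_{j=1}^k a_jx_{n_j}\|$ exists and equals $\|\sum_j a_je_j\|$ (a seminorm/norm on sequences). $Y^{(m)}$ denotes the $m$-th iterated dual of $Y$. *)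

theory Defs
  imports "HOL-Analysis.Analysis"
begin

definition coarse_embedding :: "('a::real_normed_vector \<Rightarrow> 'b::real_normed_vector) \<Rightarrow> bool" where
  "coarse_embedding f \<longleftrightarrow>
     (\<exists>\<rho> \<omega> :: real \<Rightarrow> real.
        mono_on {0..} \<rho> \<and> mono_on {0..} \<omega> \<and>
        (\<forall>t\<ge>0. \<rho> t \<ge> 0 \<and> \<omega> t \<ge> 0) \<and>
        filterlim \<rho> at_top at_top \<and>
        (\<forall>x y. \<rho> (norm (x - y)) \<le> norm (f x - f y) \<and> norm (f x - f y) \<le> \<omega> (norm (x - y))))"

definition l1_space :: "(nat \<Rightarrow> real) set" where
  "l1_space = {a. summable (\<lambda>n. \<bar>a n\<bar>)}"

definition l1_norm :: "(nat \<Rightarrow> real) \<Rightarrow> real" where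
  "l1_norm a = (\<Sum>n. \<bar>a n\<bar>)"

definition l1_embeds_into :: "'a::real_normed_vector itself \<Rightarrow> bool" where
  "l1_embeds_into _ \<longleftrightarrow>
     (\<exists>(T :: (nat \<Rightarrow> real) \<Rightarrow> 'a) c C.
        0 < c \<and>
        (\<forall>a\<in>l1_space. \<forall>b\<in>l1_space. T (\<lambda>n. a n + b n) = T a + T b) \<and>
        (\<forall>r. \<forall>a\<in>l1_space. T (\<lambda>n. r * a n) = r *\<^sub>R T a) \<and>
        (\<forall>a\<in>l1_space. c * l1_norm a \<le> norm (T a) \<and> norm (T a) \<le> C * l1_norm a))"

definition weakly_null :: "(nat \<Rightarrow> 'a::real_normed_vector) \<Rightarrow> bool" where
  "weakly_null x \<longleftrightarrow> (\<forall>f :: 'a \<Rightarrow>\<^sub>L real. (\<lambda>n. blinfun_apply f (x n)) \<longlonglongrightarrow> 0)"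

text \<open>Iterated limit: itlim j F p L means
  lim_{n_1} ... lim_{n_j} F (p @ [n_1,...,n_j]) exists and equals L
  (each limit taken as the respective index tends to infinity, so
  eventually n_1 < ... < n_j).\<close>
fun itlim :: "nat \<Rightarrow> (nat list \<Rightarrow> real) \<Rightarrow> nat list \<Rightarrow> real \<Rightarrow> bool" where
  "itlim 0 F p L \<longleftrightarrow> F p = L"
| "itlim (Suc j) F p L \<longleftrightarrow>
     (\<exists>G :: nat \<Rightarrow> real. (\<forall>\<^sub>F n in sequentially. itlim j F (p @ [n]) (G n)) \<and> G \<longlonglongrightarrow> L)"

text \<open>N k a stands for the norm of sum_{j<k} a_j e_j of the spreading model.\<close>
definition generates_spreading_model ::
    "(nat \<Rightarrow> 'a::real_normed_vector) \<Rightarrow> (nat \<Rightarrow> (nat \<Rightarrow> real) \<Rightarrow> real) \<Rightarrow> bool" where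
  "generates_spreading_model x N \<longleftrightarrow>
     (\<forall>k a. itlim k (\<lambda>p. norm (\<Sum>j<length p. a j *\<^sub>R x (p ! j))) [] (N k a))"

definition sm_equiv_l1 :: "(nat \<Rightarrow> (nat \<Rightarrow> real) \<Rightarrow> real) \<Rightarrow> bool" where
  "sm_equiv_l1 N \<longleftrightarrow>
     (\<exists>c C. 0 < c \<and> (\<forall>k a. c * (\<Sum>j<k. \<bar>a j\<bar>) \<le> N k a \<and> N k a \<le> C * (\<Sum>j<k. \<bar>a j\<bar>)))"

definition bdd_lin_functional_on :: "'u::real_normed_vector set \<Rightarrow> ('u \<Rightarrow> real) \<Rightarrow> bool" where
  "bdd_lin_functional_on V f \<longleftrightarrow>
     (\<forall>u\<in>V. \<forall>v\<in>V. f (u + v) = f u + f v) \<and>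
     (\<forall>r. \<forall>v\<in>V. f (r *\<^sub>R v) = r * f v) \<and>
     (\<exists>B. \<forall>v\<in>V. \<bar>f v\<bar> \<le> B * norm v)"

text \<open>W, with the pairing T, is an (isometrically isomorphic) copy of the dual of
  the normed space V: T is a linear bijection from W onto the bounded linear
  functionals on V, and the norm of W is the dual norm.\<close>
definition dual_copy :: "'u::real_normed_vector set \<Rightarrow> 'u set \<Rightarrow> ('u \<Rightarrow> 'u \<Rightarrow> real) \<Rightarrow> bool" where
  "dual_copy V W T \<longleftrightarrow>
     subspace V \<and> subspace W \<and>
     (\<forall>w\<in>W. bdd_lin_functional_on V (T w)) \<and>
     (\<forall>w1\<in>W. \<forall>w2\<in>W. \<forall>v\<in>V. T (w1 + w2) v = T w1 v + T w2 v) \<and>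
     (\<forall>r. \<forall>w\<in>W. \<forall>v\<in>V. T (r *\<^sub>R w) v = r * T w v) \<and>
     (\<forall>w\<in>W. norm w = (SUP v\<in>{v\<in>V. norm v \<le> 1}. \<bar>T w v\<bar>)) \<and>
     (\<forall>f. bdd_lin_functional_on V f \<longrightarrow> (\<exists>w\<in>W. \<forall>v\<in>V. T w v = f v))"

definition isometric_copy :: "'b::real_normed_vector itself \<Rightarrow> 'u::real_normed_vector set \<Rightarrow> bool" where
  "isometric_copy _ V \<longleftrightarrow>
     (\<exists>J :: 'b \<Rightarrow> 'u. linear J \<and> (\<forall>y. norm (J y) = norm y) \<and> range J = V)"

definition iterated_duals :: "'b::real_normed_vector itself \<Rightarrow> (nat \<Rightarrow> 'u::real_normed_vector set)
      \<Rightarrow> (nat \<Rightarrow> 'u \<Rightarrow> 'u \<Rightarrow> real) \<Rightarrow> bool" where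
  "iterated_duals Y Vs Ts \<longleftrightarrow> isometric_copy Y (Vs 0) \<and> (\<forall>n. dual_copy (Vs n) (Vs (Suc n)) (Ts n))"

end

theory Submission
  imports Defs "HOL-Library.Diagonal_Subsequence"
begin

text \<open>Kalton's argument, with all limits taken along one ultrafilter on the natural numbers. The weak-star
  limits of sequences of \<open>X\<close> form a non-separable subset of the bidual, because \<open>X\<close> does not
  contain a copy of l1 and its bidual is not separable. So there are uncountably many \<open>\<theta>\<close>-separated limits
  \<open>z\<close> of weakly Cauchy sequences \<open>x z\<close>. As no normalized weakly null sequence has an l1 spreading model,
  \<open>x z p\<^sub>1 - x z q\<^sub>1 + \<dots> + x z p\<^sub>k - x z q\<^sub>k\<close> with \<open>p\<^sub>1 < q\<^sub>1 < p\<^sub>2 < \<dots> < q\<^sub>k\<close> has norm at most \<open>e k\<close> for a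
  suitable \<open>k\<close>, which can be chosen to be the same for uncountably many \<open>z\<close>. Hence the image under
  \<open>f\<close> of \<open>(x z p\<^sub>1 + \<dots> + x z p\<^sub>k) / (e k)\<close> changes by at most \<open>\<omega> 1\<close> when \<open>p\<close> is replaced by
  \<open>q\<close>, while the images for different \<open>z\<close> are at least \<open>\<rho> (\<theta> / (2 e))\<close> apart. If \<open>Y\<close> has a separable dual of
  order \<open>2 k\<close>, two of the iterated weak-star limits of these images are at distance less than 1.
  Pairing the images at \<open>q\<close> with norming functionals chosen at \<open>p\<close> and passing to the limit gives
  \<open>\<rho> (\<theta> / (2 e)) \<le> 2 \<omega> 1 + 1\<close>, which is false for small \<open>e\<close>.\<close>

subsection \<open>Ultrafilters\<close>

text \<open>Bounded quantities always converge along an ultrafilter, so neither the asymptotic norms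
  nor the limits in the duals require Ramsey-type passages to subsequences; a sequence is extracted
  only where a spreading model or a weakly Cauchy sequence is demanded. Interlacing makes a pair
  \<open>(p, q)\<close> a single index: \<open>x p - x q\<close> is a family along a product
  ultrafilter, and its k-fold asymptotic norm controls almost all interlaced tuples. The obstacle is
  that \<open>k\<close> comes out of a proof by contradiction and depends on \<open>z\<close>, while
  two points can only be compared at the same \<open>k\<close>. Uncountability of the separated set
  pays for this, and once more for the pigeonhole in the separable dual. The norming functional
  depends on \<open>p\<close> but not on \<open>q\<close>, so the limits over \<open>q\<close> and
  over \<open>p\<close> can be taken one after the other; each limit lifts its vector by two orders,
  which is where \<open>2 * k\<close> comes from.\<close>

definition ultra :: "'i filter \<Rightarrow> bool" where
  "ultra U \<longleftrightarrow> U \<noteq> bot \<and> (\<forall>P. eventually P U \<or> eventually (\<lambda>x. \<not> P x) U)"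

lemma ultra_not_bot: "ultra U \<Longrightarrow> U \<noteq> bot"
  by (simp add: ultra_def)

text \<open>A minimal proper filter below \<open>F\<close> decides every predicate, since
  restricting it to a predicate gives either \<open>bot\<close> or nothing smaller. Zorn's lemma is
  applied to the reversed order; the infimum of a chain stays proper because each of its events
  already holds along a member.\<close>

lemma ultra_exists:
  assumes "F \<noteq> bot"
  obtains U where "ultra U" "U \<le> F"
proof -
  define A where "A = {G. G \<le> F \<and> G \<noteq> bot}"
  have "\<exists>m\<in>A. \<forall>a\<in>A. (a \<le> m) \<longrightarrow> a = m"
  proof (rule predicate_Zorn)
    show "partial_order_on A (relation_of (\<lambda>x y. y \<le> x) A)"
      by (auto simp: partial_order_on_def preorder_on_def refl_on_def trans_def antisym_def relation_of_def)
    fix C assume C: "C \<in> Chains (relation_of (\<lambda>x y. y \<le> x) A)"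
    show "\<exists>u\<in>A. \<forall>a\<in>C. u \<le> a"
    proof (cases "C = {}")
      case True
      then show ?thesis using assms by (auto simp: A_def)
    next
      case False
      have sub: "a \<in> A" if "a \<in> C" for a
        using C that by (auto simp: Chains_def relation_of_def)
      have ch: "a \<le> b \<or> b \<le> a" if "a \<in> C" "b \<in> C" for a b
        using C that by (auto simp: Chains_def relation_of_def)
      have ev: "eventually P (Inf C) \<longleftrightarrow> (\<exists>b\<in>C. eventually P b)" for P
        proof (rule eventually_Inf_base[OF False])
        fix F G assume "F \<in> C" "G \<in> C"
        then show "\<exists>x\<in>C. x \<le> inf F G" using ch[of F G] by (auto intro: bexI[of _ F] bexI[of _ G])
      qed
      have "Inf C \<noteq> bot"
        using ev[of "\<lambda>_. False"] sub by (auto simp: A_def trivial_limit_def)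
      moreover have "Inf C \<le> F"
        using False sub by (metis (no_types, lifting) A_def Inf_lower2 ex_in_conv mem_Collect_eq)
      ultimately have "Inf C \<in> A" by (simp add: A_def)
      then show ?thesis by (meson Inf_lower)
    qed
  qed
  then obtain m where m: "m \<in> A" "\<And>a. a \<in> A \<Longrightarrow> a \<le> m \<Longrightarrow> a = m" by blast
  have "eventually P m \<or> eventually (\<lambda>x. \<not> P x) m" for P
  proof (cases "inf m (principal {x. P x}) = bot")
    case True
    then show ?thesis
      by (simp add: trivial_limit_def eventually_inf_principal)
  next
    case False
    then have "inf m (principal {x. P x}) = m"
      using m by (intro m(2)) (auto simp: A_def le_infI1)
    moreover have "eventually P (inf m (principal {x. P x}))"
      by (simp add: eventually_inf_principal)
    ultimately show ?thesis by simp
  qed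
  then show ?thesis using that[of m] m(1) by (auto simp: ultra_def A_def)
qed

text \<open>By compactness the image filter has a cluster point, and along an ultrafilter a cluster
  point is a limit.\<close>

lemma ultra_tendsto_Lim:
  fixes g :: "'i \<Rightarrow> real"
  assumes U: "ultra U" and b: "eventually (\<lambda>i. \<bar>g i\<bar> \<le> B) U"
  shows "(g \<longlongrightarrow> Lim U g) U"
proof -
  have "compact (cball (0::real) B)" by simp
  moreover have "filtermap g U \<noteq> bot"
    using U by (simp add: ultra_def filtermap_bot_iff)
  moreover have "eventually (\<lambda>x. x \<in> cball 0 B) (filtermap g U)"
    using b by (simp add: eventually_filtermap)
  ultimately obtain l where l: "inf (nhds l) (filtermap g U) \<noteq> bot"
    unfolding compact_filter by metis
  have "(g \<longlongrightarrow> l) U"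
  proof (rule topological_tendstoI)
    fix S assume S: "open S" "l \<in> S"
    show "eventually (\<lambda>i. g i \<in> S) U"
    proof (rule ccontr)
      assume "\<not> eventually (\<lambda>i. g i \<in> S) U"
      then have "eventually (\<lambda>x. x \<notin> S) (filtermap g U)"
        using U by (auto simp: ultra_def eventually_filtermap)
      moreover have "eventually (\<lambda>x. x \<in> S) (nhds l)"
        using S eventually_nhds by blast
      ultimately have "eventually (\<lambda>x. False) (inf (nhds l) (filtermap g U))"
        unfolding eventually_inf by blast
      then show False using l by (simp add: trivial_limit_def)
    qed
  qed
  then show ?thesis
    using tendsto_Lim[of U g l] ultra_not_bot[OF U] by simp
qed

text \<open>The Fubini product of \<open>U\<close> with itself rather than the product filter:
  \<open>q\<close> is chosen after \<open>p\<close>, so for \<open>U \<le> sequentially\<close>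
  almost all pairs satisfy \<open>p < q\<close>, and ultrafilters are preserved.\<close>

definition pair_filter :: "'i filter \<Rightarrow> ('i \<times> 'i) filter" where
  "pair_filter U = Abs_filter (\<lambda>P. \<forall>\<^sub>F p in U. \<forall>\<^sub>F q in U. P (p, q))"

lemma eventually_pair_filter:
  fixes U :: "'i filter"
  shows "eventually P (pair_filter U) \<longleftrightarrow> (\<forall>\<^sub>F p in U. \<forall>\<^sub>F q in U. P (p, q))"
  unfolding pair_filter_def
proof (rule eventually_Abs_filter, rule is_filter.intro)
  fix P Q :: "'i \<times> 'i \<Rightarrow> bool"
  assume "\<forall>\<^sub>F p in U. \<forall>\<^sub>F q in U. P (p, q)" "\<forall>\<^sub>F p in U. \<forall>\<^sub>F q in U. Q (p, q)"
  then show "\<forall>\<^sub>F p in U. \<forall>\<^sub>F q in U. P (p, q) \<and> Q (p, q)"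
    by eventually_elim (auto elim: eventually_elim2)
next
  fix P Q :: "'i \<times> 'i \<Rightarrow> bool"
  assume "\<forall>x. P x \<longrightarrow> Q x" "\<forall>\<^sub>F p in U. \<forall>\<^sub>F q in U. P (p, q)"
  then show "\<forall>\<^sub>F p in U. \<forall>\<^sub>F q in U. Q (p, q)"
    by (auto elim!: eventually_mono)
qed auto

lemma ultra_pair_filter:
  assumes "ultra U"
  shows "ultra (pair_filter U)"
proof -
  have nb: "pair_filter U \<noteq> bot"
    using ultra_not_bot[OF assms] unfolding trivial_limit_def eventually_pair_filter
    by (metis (mono_tags, lifting) eventually_mono)
  have n: "\<not> eventually P U \<longleftrightarrow> eventually (\<lambda>x. \<not> P x) U" for P
  proof
    assume "eventually (\<lambda>x. \<not> P x) U"
    moreover have "\<not> eventually (\<lambda>x. False) U"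
      using ultra_not_bot[OF assms] by (simp add: trivial_limit_def)
    ultimately show "\<not> eventually P U" using eventually_elim2[of P U "\<lambda>x. \<not> P x" "\<lambda>x. False"] by auto
  qed (use assms in \<open>auto simp: ultra_def\<close>)
  have "eventually P (pair_filter U) \<or> eventually (\<lambda>x. \<not> P x) (pair_filter U)" for P
    unfolding eventually_pair_filter n[symmetric] by simp
  then show ?thesis using nb by (simp add: ultra_def)
qed

subsection \<open>Sublinear functionals\<close>

definition sublinear :: "('v::real_vector \<Rightarrow> real) \<Rightarrow> bool" where
  "sublinear p \<longleftrightarrow> (\<forall>x y. p (x + y) \<le> p x + p y) \<and> (\<forall>r\<ge>0. \<forall>x. p (r *\<^sub>R x) = r * p x)"

lemma sublinearD:
  assumes "sublinear p"
  shows "p (x + y) \<le> p x + p y" "r \<ge> 0 \<Longrightarrow> p (r *\<^sub>R x) = r * p x" "p 0 = 0" "- p (- x) \<le> p x"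
proof -
  show "p (x + y) \<le> p x + p y" "r \<ge> 0 \<Longrightarrow> p (r *\<^sub>R x) = r * p x"
    using assms by (auto simp: sublinear_def)
  have "p (0 *\<^sub>R 0) = 0 * p 0" using assms unfolding sublinear_def by blast
  then show 0: "p 0 = 0" by simp
  have "p (x + (- x)) \<le> p x + p (- x)" using assms unfolding sublinear_def by blast
  with 0 show "- p (- x) \<le> p x" by simp
qed

text \<open>The infimum makes \<open>p\<close> additive along the ray of \<open>w\<close>: the term
  \<open>t = 0\<close> gives \<open>q x \<le> p x\<close>, and \<open>t = 1\<close> at
  \<open>- w\<close> gives the last claim. Subadditivity keeps the infimum finite.\<close>

lemma sublinear_decrease:
  fixes p :: "'v::real_vector \<Rightarrow> real" and w :: 'v
  assumes p: "sublinear p"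
  obtains q where "sublinear q" "\<And>x. q x \<le> p x" "q (- w) \<le> - p w"
proof -
  define q where "q = (\<lambda>x. INF t\<in>{0..}. p (x + t *\<^sub>R w) - t * p w)"
  note P = sublinearD[OF p]
  have lb: "- p (- x) \<le> p (x + t *\<^sub>R w) - t * p w" if "t \<ge> 0" for x t
  proof -
    have "p (t *\<^sub>R w) \<le> p (x + t *\<^sub>R w) + p (- x)"
      using P(1)[of "x + t *\<^sub>R w" "- x"] by simp
    then show ?thesis using P(2)[of t w] that by simp
  qed
  have bdd: "bdd_below ((\<lambda>t. p (x + t *\<^sub>R w) - t * p w) ` {0..})" for x
    by (rule bdd_belowI2[where m = "- p (- x)"]) (use lb in auto)
  have le: "q x \<le> p (x + t *\<^sub>R w) - t * p w" if "t \<ge> 0" for x t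
    unfolding q_def by (rule cINF_lower[OF bdd]) (use that in auto)
  have ge: "c \<le> q x" if "\<And>t. t \<ge> 0 \<Longrightarrow> c \<le> p (x + t *\<^sub>R w) - t * p w" for x c
    unfolding q_def by (rule cINF_greatest) (use that in auto)
  have qp: "q x \<le> p x" for x using le[of 0 x] by simp
  have qw: "q (- w) \<le> - p w" using le[of 1 "- w"] P(3) by simp
  have add: "q (x + y) \<le> q x + q y" for x y
  proof -
    have "q (x + y) - q y \<le> q x"
    proof (rule ge)
      fix t :: real assume t: "t \<ge> 0"
      have "q (x + y) - (p (x + t *\<^sub>R w) - t * p w) \<le> q y"
      proof (rule ge)
        fix s :: real assume s: "s \<ge> 0"
        have "q (x + y) \<le> p ((x + y) + (t + s) *\<^sub>R w) - (t + s) * p w"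
          using le[of "t + s" "x + y"] s t by simp
        also have "p ((x + y) + (t + s) *\<^sub>R w) = p ((x + t *\<^sub>R w) + (y + s *\<^sub>R w))"
          by (simp add: algebra_simps)
        also have "\<dots> \<le> p (x + t *\<^sub>R w) + p (y + s *\<^sub>R w)" by (rule P(1))
        finally show "q (x + y) - (p (x + t *\<^sub>R w) - t * p w) \<le> p (y + s *\<^sub>R w) - s * p w"
          by (simp add: algebra_simps)
      qed
      then show "q (x + y) - q y \<le> p (x + t *\<^sub>R w) - t * p w" by simp
    qed
    then show ?thesis by simp
  qed
  have hom1: "r * q x \<le> q (r *\<^sub>R x)" if r: "r > 0" for r x
  proof (rule ge)
    fix t :: real assume t: "t \<ge> 0"
    have "q x \<le> p (x + (t / r) *\<^sub>R w) - (t / r) * p w"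
      using le[of "t / r" x] t r by simp
    then have "r * q x \<le> r * p (x + (t / r) *\<^sub>R w) - t * p w"
      using r by (simp add: field_simps)
    also have "r * p (x + (t / r) *\<^sub>R w) = p (r *\<^sub>R x + t *\<^sub>R w)"
      using P(2)[of r "x + (t / r) *\<^sub>R w"] r by (simp add: algebra_simps)
    finally show "r * q x \<le> p (r *\<^sub>R x + t *\<^sub>R w) - t * p w" .
  qed
  have q0: "q 0 = 0"
  proof (rule antisym)
    show "q 0 \<le> 0" using le[of 0 0] P(3) by simp
    show "0 \<le> q 0" by (rule ge) (use P(2) in auto)
  qed
  have "q (r *\<^sub>R x) = r * q x" if r: "r \<ge> 0" for r x
  proof (cases "r = 0")
    case False
    then have r: "r > 0" using r by simp
    have "(1 / r) * q (r *\<^sub>R x) \<le> q ((1 / r) *\<^sub>R (r *\<^sub>R x))"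
      using r by (intro hom1) simp
    then have "q (r *\<^sub>R x) \<le> r * q x" using r by (simp add: field_simps)
    with hom1[OF r, of x] show ?thesis by simp
  qed (simp add: q0)
  with add have "sublinear q" by (simp add: sublinear_def)
  then show ?thesis using qp qw by (rule that)
qed

text \<open>A minimal sublinear functional is linear: otherwise \<open>sublinear_decrease\<close> yields a smaller one.\<close>
lemma hahn_banach:
  fixes p :: "'v::real_vector \<Rightarrow> real"
  assumes p: "sublinear p"
  obtains h where "linear h" "\<And>x. h x \<le> p x" "h w = p w"
proof -
  \<comment> \<open>One decrease in the direction \<open>w\<close> before minimising prescribes the
    value there: a linear functional below \<open>p0\<close> satisfies
    \<open>- h w \<le> - p w\<close>.\<close>
  obtain p0 where p0: "sublinear p0" "\<And>x. p0 x \<le> p x" "p0 (- w) \<le> - p w"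
    using sublinear_decrease[OF p] by blast
  define A where "A = {q. sublinear q \<and> (\<forall>x. q x \<le> p0 x)}"
  have "\<exists>m\<in>A. \<forall>a\<in>A. a \<le> m \<longrightarrow> a = m"
  proof (rule predicate_Zorn)
    show "partial_order_on A (relation_of (\<lambda>x y. y \<le> x) A)"
      by (auto simp: partial_order_on_def preorder_on_def refl_on_def trans_def antisym_def relation_of_def)
    fix C assume C: "C \<in> Chains (relation_of (\<lambda>x y. y \<le> x) A)"
    show "\<exists>u\<in>A. \<forall>a\<in>C. u \<le> a"
    proof (cases "C = {}")
      case True
      then show ?thesis using p0 by (auto simp: A_def)
    next
      case False
      have sub: "a \<in> A" if "a \<in> C" for a
        using C that by (auto simp: Chains_def relation_of_def)
      have ch: "a \<le> b \<or> b \<le> a" if "a \<in> C" "b \<in> C" for a b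
        using C that by (auto simp: Chains_def relation_of_def)
      define u where "u = (\<lambda>x. INF a\<in>C. a x)"
      have lb: "- p0 (- x) \<le> a x" if "a \<in> C" for a x
      proof -
        have "sublinear a" "a (- x) \<le> p0 (- x)" using sub[OF that] by (auto simp: A_def)
        then show ?thesis using sublinearD(4)[of a x] by linarith
      qed
      have bdd: "bdd_below ((\<lambda>a. a x) ` C)" for x
        by (rule bdd_belowI2[where m = "- p0 (- x)"]) (use lb in auto)
      have le: "u x \<le> a x" if "a \<in> C" for a x
        unfolding u_def by (rule cINF_lower[OF bdd that])
      have ge: "c \<le> u x" if "\<And>a. a \<in> C \<Longrightarrow> c \<le> a x" for x c
        unfolding u_def by (rule cINF_greatest[OF False]) (use that in auto)
      have "u (x + y) \<le> u x + u y" for x y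
      proof -
        have "u (x + y) - u y \<le> u x"
        proof (rule ge)
          fix a assume a: "a \<in> C"
          have "u (x + y) - a x \<le> u y"
          proof (rule ge)
            fix b assume b: "b \<in> C"
            \<comment> \<open>Two members of the chain may enter the sum; the smaller of them is
              subadditive by itself and lies below both.\<close>
            obtain c where c: "c \<in> C" "c \<le> a" "c \<le> b" using ch[OF a b] a b by blast
            have "u (x + y) \<le> c x + c y"
              using le[OF c(1), of "x + y"] sublinearD(1)[of c x y] sub[OF c(1)]
              by (auto simp: A_def)
            also have "\<dots> \<le> a x + b y" using c by (auto simp: le_fun_def intro: add_mono)
            finally show "u (x + y) - a x \<le> b y" by simp
          qed
          then show "u (x + y) - u y \<le> a x" by simp
        qed
        then show ?thesis by simp
      qed
      moreover have "u (r *\<^sub>R x) = r * u x" if r: "r \<ge> 0" for r x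
      proof (cases "r = 0")
        case True
        obtain a where a: "a \<in> C" using False by blast
        have b0: "b 0 = 0" if "b \<in> C" for b
          using sub[OF that] sublinearD(3) by (auto simp: A_def)
        have "u 0 \<le> 0" using le[OF a, of 0] b0[OF a] by simp
        moreover have "0 \<le> u 0" by (rule ge) (simp add: b0)
        ultimately show ?thesis using True by simp
      next
        case False
        then have r: "r > 0" using r by simp
        have h: "a (r *\<^sub>R x) = r * a x" if "a \<in> C" for a
          using sub[OF that] sublinearD(2)[of a r x] r by (auto simp: A_def)
        show ?thesis
        proof (rule antisym)
          have "u (r *\<^sub>R x) / r \<le> u x"
          proof (rule ge)
            fix a assume "a \<in> C"
            then show "u (r *\<^sub>R x) / r \<le> a x"
              using le[of a "r *\<^sub>R x"] h[of a] r by (simp add: field_simps)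
          qed
          then show "u (r *\<^sub>R x) \<le> r * u x" using r by (simp add: field_simps)
          show "r * u x \<le> u (r *\<^sub>R x)"
          proof (rule ge)
            fix a assume "a \<in> C"
            then show "r * u x \<le> a (r *\<^sub>R x)"
              using le[of a x] h[of a] r by simp
          qed
        qed
      qed
      moreover have "u x \<le> p0 x" for x
      proof -
        obtain a where a: "a \<in> C" using False by blast
        have "a x \<le> p0 x" using sub[OF a] by (simp add: A_def)
        then show ?thesis using le[OF a, of x] by linarith
      qed
      ultimately have "u \<in> A" by (simp add: A_def sublinear_def)
      then show ?thesis using le by (auto simp: le_fun_def)
    qed
  qed
  then obtain m where m: "m \<in> A" "\<And>a. a \<in> A \<Longrightarrow> a \<le> m \<Longrightarrow> a = m" by blast
  have sm: "sublinear m" and mp: "\<And>x. m x \<le> p0 x" using m(1) by (auto simp: A_def)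
  have add: "m (x + y) = m x + m y" for x y
  proof (rule antisym)
    show "m (x + y) \<le> m x + m y" by (rule sublinearD(1)[OF sm])
    obtain q where q: "sublinear q" "\<And>x. q x \<le> m x" "q (- y) \<le> - m y"
      using sublinear_decrease[OF sm] by blast
    have "q z \<le> p0 z" for z using q(2)[of z] mp[of z] by linarith
    then have "q \<in> A" using q(1) by (simp add: A_def)
    then have "q = m" using q(2) by (intro m(2)) (auto simp: le_fun_def)
    then have "m (- y) \<le> - m y" using q(3) by simp
    then show "m x + m y \<le> m (x + y)"
      using sublinearD(1)[OF sm, of "x + y" "- y"] by simp
  qed
  have lin: "linear m"
  proof (rule linearI)
    fix r x
    have neg: "m (- z) = - m z" for z
      using add[of z "- z"] sublinearD(3)[OF sm] by simp
    show "m (r *\<^sub>R x) = r *\<^sub>R m x"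
    proof (cases "r \<ge> 0")
      case True
      then show ?thesis using sublinearD(2)[OF sm] by simp
    next
      case False
      then have "m ((- r) *\<^sub>R x) = (- r) * m x" by (intro sublinearD(2)[OF sm]) auto
      then show ?thesis using neg[of "r *\<^sub>R x"] by simp
    qed
  qed (rule add)
  have mp': "m x \<le> p x" for x using mp[of x] p0(2)[of x] by simp
  have "- m w \<le> - p w" using mp[of "- w"] p0(3) linear_neg[OF lin, of w] by simp
  with mp'[of w] have "m w = p w" by simp
  with lin mp' show ?thesis by (rule that)
qed

lemma sublinear_norm: "sublinear (norm :: 'v::real_normed_vector \<Rightarrow> real)"
  by (simp add: sublinear_def norm_triangle_ineq)

lemma bounded_linear_of_le_norm:
  fixes h :: "'v::real_normed_vector \<Rightarrow> real"
  assumes "linear h" "\<And>x. h x \<le> norm x"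
  shows "bounded_linear h" "\<bar>h x\<bar> \<le> norm x"
proof -
  show "\<bar>h x\<bar> \<le> norm x" for x
    using assms(2)[of x] assms(2)[of "- x"] linear_neg[OF assms(1), of x] by simp
  then show "bounded_linear h"
    by (intro bounded_linear_intro[where K = 1] linear_add[OF assms(1)])
       (use linear_cmul[OF assms(1)] in auto)
qed

subsection \<open>Asymptotic norms along an ultrafilter\<close>

text \<open>The iterated limit of \<open>norm (u + a 0 *\<^sub>R y i\<^sub>0 + \<dots>)\<close> over
  \<open>k\<close> indices. The offset \<open>u\<close> collects the terms whose indices are already
  fixed; at \<open>u = 0\<close> this is the candidate for a spreading model norm.\<close>

primrec asym_norm ::
    "'i filter \<Rightarrow> ('i \<Rightarrow> 'a::real_normed_vector) \<Rightarrow> nat \<Rightarrow> (nat \<Rightarrow> real) \<Rightarrow> 'a \<Rightarrow> real" where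
  "asym_norm V y 0 a u = norm u"
| "asym_norm V y (Suc k) a u = Lim V (\<lambda>i. asym_norm V y k (\<lambda>j. a (Suc j)) (u + a 0 *\<^sub>R y i))"

lemma sum_lessThan_Suc_head: "(\<Sum>j<Suc k. g j) = g 0 + (\<Sum>j<k. g (Suc j))"
  for g :: "nat \<Rightarrow> 'b::comm_monoid_add"
  by (rule sum.lessThan_Suc_shift)

text \<open>The index type is left open because the families of interest are indexed by
  pairs.\<close>

locale bounded_along =
  fixes V :: "'i filter" and y :: "'i \<Rightarrow> 'a::real_normed_vector" and B :: real
  assumes ultra: "ultra V" and bounded: "eventually (\<lambda>i. norm (y i) \<le> B) V"
begin

abbreviation nrm where "nrm \<equiv> asym_norm V y"

lemma not_bot: "V \<noteq> bot"
  using ultra by (rule ultra_not_bot)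

lemma B_nonneg: "0 \<le> B"
proof -
  have "eventually (\<lambda>i. 0 \<le> B) V"
    using bounded by eventually_elim (rule order_trans[OF norm_ge_zero])
  then show ?thesis using not_bot by (simp add: eventually_const_iff)
qed

text \<open>Bounds and convergence go through one induction: \<open>Lim\<close> is meaningful only
  for bounded families, and the bounds at the next level are inherited through the convergence at
  this one.\<close>

lemma nrm_aux:
  "0 \<le> nrm k a u \<and> nrm k a u \<le> norm u + B * (\<Sum>j<k. \<bar>a j\<bar>) \<and>
   ((\<lambda>i. nrm k (\<lambda>j. c (Suc j)) (w + c 0 *\<^sub>R y i)) \<longlongrightarrow> nrm (Suc k) c w) V"
proof (induction k arbitrary: a u c w)
  case 0
  have "eventually (\<lambda>i. \<bar>norm (w + c 0 *\<^sub>R y i)\<bar> \<le> norm w + \<bar>c 0\<bar> * B) V"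
    using bounded
  proof eventually_elim
    fix i assume "norm (y i) \<le> B"
    then have "norm (c 0 *\<^sub>R y i) \<le> \<bar>c 0\<bar> * B" by (simp add: mult_left_mono)
    then show "\<bar>norm (w + c 0 *\<^sub>R y i)\<bar> \<le> norm w + \<bar>c 0\<bar> * B"
      using norm_triangle_ineq[of w "c 0 *\<^sub>R y i"] by simp
  qed
  from ultra_tendsto_Lim[OF ultra this] show ?case by simp
next
  case (Suc k)
  have bd: "eventually (\<lambda>i. 0 \<le> nrm k (\<lambda>j. a (Suc j)) (u + a 0 *\<^sub>R y i) \<and>
      nrm k (\<lambda>j. a (Suc j)) (u + a 0 *\<^sub>R y i) \<le> norm u + B * (\<Sum>j<Suc k. \<bar>a j\<bar>)) V" for a u
    using bounded
  proof eventually_elim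
    fix i assume "norm (y i) \<le> B"
    then have "norm (a 0 *\<^sub>R y i) \<le> \<bar>a 0\<bar> * B" by (simp add: mult_left_mono)
    then have "norm (u + a 0 *\<^sub>R y i) \<le> norm u + \<bar>a 0\<bar> * B"
      using norm_triangle_ineq[of u "a 0 *\<^sub>R y i"] by simp
    then show "0 \<le> nrm k (\<lambda>j. a (Suc j)) (u + a 0 *\<^sub>R y i) \<and>
      nrm k (\<lambda>j. a (Suc j)) (u + a 0 *\<^sub>R y i) \<le> norm u + B * (\<Sum>j<Suc k. \<bar>a j\<bar>)"
      using Suc.IH[of "\<lambda>j. a (Suc j)" "u + a 0 *\<^sub>R y i" undefined undefined]
      unfolding sum_lessThan_Suc_head by (simp add: algebra_simps)
  qed
  have lim: "((\<lambda>i. nrm k (\<lambda>j. a (Suc j)) (u + a 0 *\<^sub>R y i)) \<longlongrightarrow> nrm (Suc k) a u) V" for a u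
    using Suc.IH by blast
  have le: "0 \<le> nrm (Suc k) a u \<and> nrm (Suc k) a u \<le> norm u + B * (\<Sum>j<Suc k. \<bar>a j\<bar>)" for a u
    using tendsto_lowerbound[OF lim _ not_bot, of 0 a u] tendsto_upperbound[OF lim _ not_bot, of a u]
      eventually_conj_iff[THEN iffD1, OF bd[of a u]] by blast
  have "eventually (\<lambda>i. \<bar>nrm (Suc k) (\<lambda>j. c (Suc j)) (w + c 0 *\<^sub>R y i)\<bar>
      \<le> norm w + \<bar>c 0\<bar> * B + B * (\<Sum>j<Suc k. \<bar>c (Suc j)\<bar>)) V"
    using bounded
  proof eventually_elim
    fix i assume "norm (y i) \<le> B"
    then have "norm (c 0 *\<^sub>R y i) \<le> \<bar>c 0\<bar> * B" by (simp add: mult_left_mono)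
    then show "\<bar>nrm (Suc k) (\<lambda>j. c (Suc j)) (w + c 0 *\<^sub>R y i)\<bar>
      \<le> norm w + \<bar>c 0\<bar> * B + B * (\<Sum>j<Suc k. \<bar>c (Suc j)\<bar>)"
      using norm_triangle_ineq[of w "c 0 *\<^sub>R y i"]
        le[of "\<lambda>j. c (Suc j)" "w + c 0 *\<^sub>R y i"] by linarith
  qed
  from ultra_tendsto_Lim[OF ultra this] show ?case
    using le by (subst (3) asym_norm.simps) blast
qed

lemma nrm_le: "nrm k a u \<le> norm u + B * (\<Sum>j<k. \<bar>a j\<bar>)"
  using nrm_aux by blast

lemma nrm_tendsto:
  "((\<lambda>i. nrm k (\<lambda>j. a (Suc j)) (u + a 0 *\<^sub>R y i)) \<longlongrightarrow> nrm (Suc k) a u) V"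
  using nrm_aux by blast

declare asym_norm.simps(2) [simp del]

lemma nrm_triangle: "nrm k (\<lambda>j. a j + b j) (u + v) \<le> nrm k a u + nrm k b v"
proof (induction k arbitrary: a b u v)
  case 0
  show ?case by (simp add: norm_triangle_ineq)
next
  case (Suc k)
  have "nrm k (\<lambda>j. a (Suc j) + b (Suc j)) ((u + v) + (a 0 + b 0) *\<^sub>R y i)
      \<le> nrm k (\<lambda>j. a (Suc j)) (u + a 0 *\<^sub>R y i) + nrm k (\<lambda>j. b (Suc j)) (v + b 0 *\<^sub>R y i)" for i
    using Suc.IH[of "\<lambda>j. a (Suc j)" "\<lambda>j. b (Suc j)" "u + a 0 *\<^sub>R y i" "v + b 0 *\<^sub>R y i"]
    by (simp add: algebra_simps)
  then show ?case
    by (intro tendsto_le[OF not_bot tendsto_add[OF nrm_tendsto nrm_tendsto]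
          nrm_tendsto[of k "\<lambda>j. a j + b j" "u + v"]]) simp
qed

lemma nrm_scale: "nrm k (\<lambda>j. r * a j) (r *\<^sub>R u) = \<bar>r\<bar> * nrm k a u"
proof (induction k arbitrary: a u)
  case (Suc k)
  have "((\<lambda>i. nrm k (\<lambda>j. r * a (Suc j)) (r *\<^sub>R u + (r * a 0) *\<^sub>R y i)) \<longlongrightarrow> nrm (Suc k) (\<lambda>j. r * a j) (r *\<^sub>R u)) V"
    using nrm_tendsto[of k "\<lambda>j. r * a j" "r *\<^sub>R u"] .
  moreover have "nrm k (\<lambda>j. r * a (Suc j)) (r *\<^sub>R u + (r * a 0) *\<^sub>R y i)
      = \<bar>r\<bar> * nrm k (\<lambda>j. a (Suc j)) (u + a 0 *\<^sub>R y i)" for i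
    using Suc.IH[of "\<lambda>j. a (Suc j)" "u + a 0 *\<^sub>R y i"] by (simp add: scaleR_add_right)
  ultimately have "((\<lambda>i. \<bar>r\<bar> * nrm k (\<lambda>j. a (Suc j)) (u + a 0 *\<^sub>R y i)) \<longlongrightarrow> nrm (Suc k) (\<lambda>j. r * a j) (r *\<^sub>R u)) V"
    by simp
  with tendsto_mult_left[OF nrm_tendsto] show ?case
    by (rule tendsto_unique[OF not_bot, rotated])
qed simp

lemma nrm_Lipschitz: "\<bar>nrm k a u - nrm k b v\<bar> \<le> norm (u - v) + B * (\<Sum>j<k. \<bar>a j - b j\<bar>)"
proof -
  have *: "nrm k a u \<le> nrm k b v + (norm (u - v) + B * (\<Sum>j<k. \<bar>a j - b j\<bar>))" for a u b v
  proof -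
    have "nrm k (\<lambda>j. b j + (a j - b j)) (v + (u - v)) \<le> nrm k b v + nrm k (\<lambda>j. a j - b j) (u - v)"
      by (rule nrm_triangle)
    also have "\<dots> \<le> nrm k b v + (norm (u - v) + B * (\<Sum>j<k. \<bar>a j - b j\<bar>))"
      by (intro add_left_mono nrm_le)
    finally show ?thesis by simp
  qed
  show ?thesis using *[of a u b v] *[of b v a u]
    by (simp add: abs_le_iff norm_minus_commute abs_minus_commute)
qed

lemma nrm_cong: "(\<And>j. j < k \<Longrightarrow> a j = b j) \<Longrightarrow> nrm k a u = nrm k b u"
  using nrm_Lipschitz[of k a u b u] by simp

lemma nrm_zero_head:
  assumes "a 0 = 0"
  shows "nrm (Suc k) a u = nrm k (\<lambda>j. a (Suc j)) u"
  using nrm_tendsto[of k a u] assms not_bot by (simp add: tendsto_const_iff)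

lemma nrm_zero: "(\<And>j. j < k \<Longrightarrow> a j = 0) \<Longrightarrow> nrm k a u = norm u"
  by (induction k arbitrary: a) (auto simp: nrm_zero_head)

lemma nrm_zero_tail: "(\<And>j. k \<le> j \<Longrightarrow> a j = 0) \<Longrightarrow> nrm (k + m) a u = nrm k a u"
proof (induction k arbitrary: a u)
  case (Suc k)
  have "nrm (k + m) (\<lambda>j. a (Suc j)) v = nrm k (\<lambda>j. a (Suc j)) v" for v
    using Suc.prems by (intro Suc.IH) auto
  then show ?case by (simp add: asym_norm.simps(2))
qed (simp add: nrm_zero)

lemma nrm_shift: "nrm (s + k) (\<lambda>j. if j < s then 0 else a (j - s)) u = nrm k a u"
proof (induction s)
  case (Suc s)
  have "(\<lambda>j. if Suc j < Suc s then 0 else a (Suc j - Suc s)) = (\<lambda>j. if j < s then 0 else a (j - s))"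
    by (auto simp del: diff_Suc_Suc simp: diff_Suc_Suc)
  with Suc.IH show ?case by (simp add: nrm_zero_head del: diff_Suc_Suc)
qed simp

lemma nrm_sum:
  assumes "finite S"
  shows "nrm k (\<lambda>j. \<Sum>s\<in>S. b s j) 0 \<le> (\<Sum>s\<in>S. nrm k (b s) 0)"
  using assms
proof (induction S)
  case (insert s S)
  have "nrm k (\<lambda>j. b s j + (\<Sum>s\<in>S. b s j)) (0 + 0) \<le> nrm k (b s) 0 + nrm k (\<lambda>j. \<Sum>s\<in>S. b s j) 0"
    by (rule nrm_triangle)
  then show ?case using insert by simp
qed (simp add: nrm_zero)

text \<open>Weak lower semicontinuity of a convex function, by a supporting functional at
  \<open>u\<close> whose linear part is norm continuous and therefore vanishes along the weakly null
  \<open>y\<close>.\<close>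

lemma nrm_weakly_lsc:
  assumes weak: "\<And>h. bounded_linear h \<Longrightarrow> ((\<lambda>i. h (y i)) \<longlongrightarrow> (0::real)) V"
    and l: "((\<lambda>i. nrm k a (u + t *\<^sub>R y i)) \<longlongrightarrow> l) V"
  shows "nrm k a u \<le> l"
proof -
  \<comment> \<open>Homogenisation: the extra coordinate scales the coefficients, which turns the
    convex function \<open>nrm k a\<close> into a sublinear one. At second coordinate 0 it is the
    norm, hence the bound on \<open>g\<close> below.\<close>
  define p where "p = (\<lambda>(v, r). nrm k (\<lambda>j. r * a j) v)"
  have "sublinear p"
    unfolding sublinear_def
  proof (intro conjI allI impI)
    fix x z
    show "p (x + z) \<le> p x + p z"
      using nrm_triangle[of k "\<lambda>j. snd x * a j" "\<lambda>j. snd z * a j" "fst x" "fst z"]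
      by (simp add: p_def case_prod_beta distrib_right)
  next
    fix r :: real and x assume "0 \<le> r"
    then show "p (r *\<^sub>R x) = r * p x"
      using nrm_scale[of k r "\<lambda>j. snd x * a j" "fst x"]
      by (simp add: p_def case_prod_beta mult.assoc)
  qed
  then obtain h where h: "linear h" "\<And>x. h x \<le> p x" "h (u, 1) = p (u, 1)"
    using hahn_banach[of p "(u, 1)"] by blast
  define g where "g = (\<lambda>v. h (v, 0))"
  have add: "h (v, r) = g v + h (0, r)" for v r
    using linear_add[OF h(1), of "(v, 0)" "(0, r)"] by (simp add: g_def)
  have "linear g"
  proof (rule linearI)
    show "g (v + w) = g v + g w" for v w
      using linear_add[OF h(1), of "(v, 0)" "(w, 0)"] by (simp add: g_def)
    show "g (r *\<^sub>R v) = r *\<^sub>R g v" for r v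
      using linear_cmul[OF h(1), of r "(v, 0)"] by (simp add: g_def)
  qed
  moreover have "g v \<le> norm v" for v
    using h(2)[of "(v, 0)"] by (simp add: g_def p_def nrm_zero)
  ultimately have "bounded_linear g" by (rule bounded_linear_of_le_norm)
  then have "((\<lambda>i. nrm k a u + t * g (y i)) \<longlongrightarrow> nrm k a u + t * 0) V"
    by (intro tendsto_intros weak)
  moreover have "nrm k a u + t * g (y i) \<le> nrm k a (u + t *\<^sub>R y i)" for i
  proof -
    have "nrm k a u + t * g (y i) = h (u, 1) + t * g (y i)" using h(3) by (simp add: p_def)
    also have "\<dots> = h (u + t *\<^sub>R y i, 1)"
      using add[of "u + t *\<^sub>R y i" 1] add[of u 1] linear_add[OF \<open>linear g\<close>] linear_cmul[OF \<open>linear g\<close>]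
      by simp
    also have "\<dots> \<le> nrm k a (u + t *\<^sub>R y i)" using h(2)[of "(u + t *\<^sub>R y i, 1)"] by (simp add: p_def)
    finally show ?thesis .
  qed
  ultimately show ?thesis using tendsto_le[OF not_bot l] by auto
qed

text \<open>A weakly null term can only raise a weakly lower semicontinuous function in the limit,
  so deleting it does not increase the norm. Deletions are made one index at a time.\<close>

lemma nrm_suppression:
  assumes weak: "\<And>h. bounded_linear h \<Longrightarrow> ((\<lambda>i. h (y i)) \<longlongrightarrow> (0::real)) V"
  shows "nrm k (\<lambda>j. if Q j then a j else 0) u \<le> nrm k a u"
proof (induction k arbitrary: a Q u)
  case (Suc k)
  note IH = Suc.IH[of "\<lambda>j. Q (Suc j)" "\<lambda>j. a (Suc j)"]
  show ?case
  proof (cases "Q 0")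
    case True
    then show ?thesis
      using nrm_tendsto[of k "\<lambda>j. if Q j then a j else 0" u] IH
      by (intro tendsto_le[OF not_bot nrm_tendsto[of k a u]]) auto
  next
    case False
    then have "nrm (Suc k) (\<lambda>j. if Q j then a j else 0) u \<le> nrm k (\<lambda>j. a (Suc j)) u"
      using IH by (simp add: nrm_zero_head)
    also have "\<dots> \<le> nrm (Suc k) a u"
      by (rule nrm_weakly_lsc[OF weak nrm_tendsto])
    finally show ?thesis .
  qed
qed simp

text \<open>Averaging the \<open>K\<close> shifts of \<open>a\<close> gives a vector that is constant away from its two ends, so the
  lower bound for constant coefficients carries over.\<close>
lemma nrm_ge_nonneg:
  assumes ones: "\<And>k. \<epsilon> * real k \<le> nrm k (\<lambda>_. 1) 0" and nonneg: "\<And>j. 0 \<le> a j"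
  shows "\<epsilon> * (\<Sum>j<k. a j) \<le> nrm k a 0"
proof -
  define A where "A = (\<Sum>j<k. a j)"
  define b where "b = (\<lambda>j. if j < k then a j else 0)"
  define c where "c = (\<lambda>s j. if j < s then 0 else b (j - s))"
  have A0: "0 \<le> A" unfolding A_def by (intro sum_nonneg nonneg)
  \<comment> \<open>The last term, caused by the two ends, does not grow with \<open>K\<close>,
    whereas the others are of order \<open>K\<close>. Large \<open>K\<close> therefore yields the
    claim.\<close>
  have main: "\<epsilon> * A * real (K + k) \<le> real K * nrm k a 0 + B * (2 * real k * A)" for K
  proof -
    have nc: "nrm (K + k) (c s) 0 = nrm k a 0" if "s < K" for s
    proof -
      have "nrm (K + k) (c s) 0 = nrm (s + (k + (K - s))) (c s) 0"
        using that by (intro arg_cong[where f = "\<lambda>n. nrm n (c s) 0"]) simp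
      also have "\<dots> = nrm (k + (K - s)) b 0" unfolding c_def by (rule nrm_shift)
      also have "\<dots> = nrm k b 0" by (rule nrm_zero_tail) (simp add: b_def)
      also have "\<dots> = nrm k a 0" by (rule nrm_cong) (simp add: b_def)
      finally show ?thesis .
    qed
    have c_sum: "(\<Sum>s<K. c s j) = (\<Sum>s\<in>{s. s < K \<and> s \<le> j \<and> j - s < k}. a (j - s))" for j
      by (rule sum.mono_neutral_cong_right) (auto simp: c_def b_def)
    have reindex: "(\<Sum>s\<in>{s. s < K \<and> s \<le> j \<and> j - s < k}. a (j - s)) = (\<Sum>i\<in>{i. i < k \<and> i \<le> j \<and> j < K + i}. a i)" for j
      by (rule sum.reindex_bij_witness[where i = "\<lambda>i. j - i" and j = "\<lambda>s. j - s"]) auto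
    \<comment> \<open>At a position in \<open>{k..<K}\<close> every \<open>a i\<close> is met by
      exactly one shift, so the column sum is \<open>A\<close>. Near the ends it is a partial sum,
      and nonnegativity keeps it between 0 and \<open>A\<close>.\<close>
    have dev: "\<bar>A - (\<Sum>s<K. c s j)\<bar> \<le> (if j < k \<or> K \<le> j then A else 0)" for j
    proof -
      have "(\<Sum>i\<in>{i. i < k \<and> i \<le> j \<and> j < K + i}. a i) \<le> A"
        unfolding A_def by (rule sum_mono2) (auto intro: nonneg)
      moreover have "0 \<le> (\<Sum>i\<in>{i. i < k \<and> i \<le> j \<and> j < K + i}. a i)"
        by (intro sum_nonneg nonneg)
      moreover have "(\<Sum>i\<in>{i. i < k \<and> i \<le> j \<and> j < K + i}. a i) = A" if "\<not> (j < k \<or> K \<le> j)"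
        unfolding A_def using that by (intro sum.cong) auto
      ultimately show ?thesis unfolding c_sum reindex by auto
    qed
    have "\<epsilon> * A * real (K + k) \<le> A * nrm (K + k) (\<lambda>_. 1) 0"
      using mult_left_mono[OF ones[of "K + k"] A0] by (simp add: mult_ac)
    also have "\<dots> = nrm (K + k) (\<lambda>_. A) 0"
      using nrm_scale[of "K + k" A "\<lambda>_. 1" 0] A0 by simp
    also have "\<dots> \<le> nrm (K + k) (\<lambda>j. \<Sum>s<K. c s j) 0 + B * (\<Sum>j<K+k. \<bar>A - (\<Sum>s<K. c s j)\<bar>)"
      using nrm_Lipschitz[of "K + k" "\<lambda>_. A" 0 "\<lambda>j. \<Sum>s<K. c s j" 0] by simp
    also have "nrm (K + k) (\<lambda>j. \<Sum>s<K. c s j) 0 \<le> (\<Sum>s<K. nrm (K + k) (c s) 0)"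
      by (rule nrm_sum) simp
    also have "(\<Sum>s<K. nrm (K + k) (c s) 0) = real K * nrm k a 0"
      using nc by simp
    also have "(\<Sum>j<K+k. \<bar>A - (\<Sum>s<K. c s j)\<bar>) \<le> (\<Sum>j<K+k. if j < k \<or> K \<le> j then A else 0)"
      by (intro sum_mono dev)
    also have "\<dots> = real (card {j. j < K + k \<and> (j < k \<or> K \<le> j)}) * A"
      by (simp add: sum.If_cases Int_def)
    also have "\<dots> \<le> 2 * real k * A"
    proof -
      have "card {j. j < K + k \<and> (j < k \<or> K \<le> j)} \<le> card ({..<k} \<union> {K..<K+k})"
        by (intro card_mono) auto
      also have "\<dots> \<le> card {..<k} + card {K..<K+k}" by (rule card_Un_le)
      finally have "real (card {j. j < K + k \<and> (j < k \<or> K \<le> j)}) \<le> 2 * real k" by simp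
      then show ?thesis by (intro mult_right_mono A0)
    qed
    finally show ?thesis using B_nonneg by (simp add: mult_left_mono)
  qed
  show ?thesis
  proof (rule ccontr)
    assume "\<not> ?thesis"
    then have d: "0 < \<epsilon> * A - nrm k a 0" by (simp add: A_def)
    have le: "real K * (\<epsilon> * A - nrm k a 0) \<le> B * (2 * real k * A) - \<epsilon> * A * real k" for K
      using main[of K] by (simp add: algebra_simps)
    obtain K where "(B * (2 * real k * A) - \<epsilon> * A * real k) / (\<epsilon> * A - nrm k a 0) < real K"
      using reals_Archimedean2 by blast
    with d have "B * (2 * real k * A) - \<epsilon> * A * real k < real K * (\<epsilon> * A - nrm k a 0)"
      by (simp add: pos_divide_less_eq)
    with le[of K] show False by simp
  qed
qed

text \<open>The positive and the negative part of \<open>a\<close> are each bounded by the whole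
  norm through suppression, and together they carry the full l1 norm. Adding the two estimates costs
  the factor 2.\<close>

lemma nrm_ge:
  assumes weak: "\<And>h. bounded_linear h \<Longrightarrow> ((\<lambda>i. h (y i)) \<longlongrightarrow> (0::real)) V"
    and ones: "\<And>k. \<epsilon> * real k \<le> nrm k (\<lambda>_. 1) 0"
  shows "\<epsilon> / 2 * (\<Sum>j<k. \<bar>a j\<bar>) \<le> nrm k a 0"
proof -
  have *: "\<epsilon> * (\<Sum>j<k. max (a j) 0) \<le> nrm k a 0" for a
  proof -
    have "\<epsilon> * (\<Sum>j<k. max (a j) 0) \<le> nrm k (\<lambda>j. max (a j) 0) 0"
      by (rule nrm_ge_nonneg[OF ones]) simp
    also have "\<dots> = nrm k (\<lambda>j. if 0 \<le> a j then a j else 0) 0"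
      by (rule nrm_cong) auto
    also have "\<dots> \<le> nrm k a 0"
      by (rule nrm_suppression[OF weak])
    finally show ?thesis .
  qed
  have "\<epsilon> * (\<Sum>j<k. max (- a j) 0) \<le> nrm k a 0"
    using *[of "\<lambda>j. - a j"] nrm_scale[of k "-1" a 0] by simp
  with *[of a] have "\<epsilon> * ((\<Sum>j<k. max (a j) 0) + (\<Sum>j<k. max (- a j) 0)) \<le> 2 * nrm k a 0"
    by (simp add: distrib_left)
  also have "(\<Sum>j<k. max (a j) 0) + (\<Sum>j<k. max (- a j) 0) = (\<Sum>j<k. \<bar>a j\<bar>)"
    by (simp add: sum.distrib[symmetric] max_def abs_if cong: sum.cong)
       (auto intro!: sum.cong)
  finally show ?thesis by simp
qed

end

section \<open>Sequences that realise the asymptotic norms\<close>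

context bounded_along
begin

text \<open>Rational coefficients and a dense sequence give countably many limits along the ultrafilter;
  a sequence of indices realising them realises all others by the Lipschitz estimate.\<close>
lemma nrm_realising_sequence:
  fixes d :: "nat \<Rightarrow> 'a"
  assumes dense: "\<And>x e. 0 < e \<Longrightarrow> \<exists>n. norm (x - d n) < e"
    and E: "\<And>n. eventually (E n) V"
  obtains \<iota> where "\<And>n. E n (\<iota> n)"
    and "\<And>k a u. (\<lambda>n. nrm k (\<lambda>j. a (Suc j)) (u + a 0 *\<^sub>R y (\<iota> n))) \<longlonglongrightarrow> nrm (Suc k) a u"
proof -
  define cf :: "rat list \<Rightarrow> nat \<Rightarrow> real" where
    "cf qs j = (if j < length qs then of_rat (qs ! j) else 0)" for qs j
  define g where "g = (\<lambda>(k, qs, m) i. nrm k (\<lambda>j. cf qs (Suc j)) (d m + cf qs 0 *\<^sub>R y i))"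
  define L where "L = (\<lambda>(k, qs, m). nrm (Suc k) (cf qs) (d m))"
  have gL: "(g t \<longlongrightarrow> L t) V" for t
    using nrm_tendsto by (cases t) (auto simp: g_def L_def)
  \<comment> \<open>The n-th index has to serve only the first \<open>n + 1\<close> tests of an
    enumeration, a finite conjunction; each fixed test is then met by all later indices, with error
    tending to 0.\<close>
  have ev: "eventually (\<lambda>i. E n i \<and> norm (y i) \<le> B \<and> (\<forall>m\<in>{..n}. \<bar>g (from_nat m) i - L (from_nat m)\<bar> < 1 / real (Suc n))) V" for n
  proof -
    have "eventually (\<lambda>i. \<bar>g (from_nat m) i - L (from_nat m)\<bar> < 1 / real (Suc n)) V" for m
      using tendstoD[OF gL[of "from_nat m"], of "1 / real (Suc n)"] by (simp add: dist_real_def)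
    then show ?thesis
      by (intro eventually_conj E bounded) (simp add: eventually_ball_finite)
  qed
  have "\<exists>i. E n i \<and> norm (y i) \<le> B \<and> (\<forall>m\<in>{..n}. \<bar>g (from_nat m) i - L (from_nat m)\<bar> < 1 / real (Suc n))" for n
    using eventually_happens[OF ev] not_bot by blast
  then obtain \<iota> where \<iota>: "\<And>n. E n (\<iota> n)" "\<And>n. norm (y (\<iota> n)) \<le> B"
    "\<And>n m. m \<le> n \<Longrightarrow> \<bar>g (from_nat m) (\<iota> n) - L (from_nat m)\<bar> < 1 / real (Suc n)"
    by (metis atMost_iff)
  have test: "(\<lambda>n. g t (\<iota> n)) \<longlonglongrightarrow> L t" for t
  proof (rule LIMSEQ_I)
    fix r :: real assume "0 < r"
    then obtain N where N: "1 / real (Suc N) < r" using nat_approx_posE by blast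
    show "\<exists>no. \<forall>n\<ge>no. norm (g t (\<iota> n) - L t) < r"
    proof (intro exI allI impI)
      fix n assume n: "n \<ge> max N (to_nat t)"
      have "\<bar>g t (\<iota> n) - L t\<bar> < 1 / real (Suc n)" using \<iota>(3)[of "to_nat t" n] n by simp
      also have "\<dots> \<le> 1 / real (Suc N)" using n by (simp add: frac_le)
      finally show "norm (g t (\<iota> n) - L t) < r" using N by simp
    qed
  qed
  have "(\<lambda>n. nrm k (\<lambda>j. a (Suc j)) (u + a 0 *\<^sub>R y (\<iota> n))) \<longlonglongrightarrow> nrm (Suc k) a u" for k a u
  proof (rule LIMSEQ_I)
    fix r :: real assume r: "0 < r"
    \<comment> \<open>Replacing \<open>u\<close> and the \<open>Suc k\<close> coefficients by
      approximations within \<open>\<delta>\<close> costs at most \<open>r / 3\<close>, once in the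
      limit and once in the sequence; the last third is left for the test function.\<close>
    define \<delta> where "\<delta> = r / 3 / (1 + B * real (Suc k))"
    have "0 < 1 + B * real (Suc k)" using B_nonneg by (simp add: add_pos_nonneg del: of_nat_Suc)
    then have \<delta>: "\<delta> > 0" "\<delta> * (1 + B * real (Suc k)) = r / 3"
      using r unfolding \<delta>_def by (simp_all del: of_nat_Suc divide_divide_eq_left)
    obtain m where m: "norm (u - d m) < \<delta>" using dense[OF \<delta>(1)] by blast
    have "\<exists>q. \<bar>a j - of_rat q\<bar> < \<delta>" for j
    proof -
      obtain q where "a j < of_rat q" "of_rat q < a j + \<delta>"
        using of_rat_dense[of "a j" "a j + \<delta>"] \<delta>(1) by auto
      then show ?thesis by (intro exI[of _ q]) linarith
    qed
    then obtain q where q: "\<And>j. \<bar>a j - of_rat (q j)\<bar> < \<delta>" by metis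
    define qs where "qs = map q [0..<Suc k]"
    have cf: "\<bar>a j - cf qs j\<bar> < \<delta>" if "j < Suc k" for j
      using that q[of j] by (simp add: cf_def qs_def del: upt_Suc)
    have sumS: "(\<Sum>j<Suc k. \<bar>a j - cf qs j\<bar>) \<le> real (Suc k) * \<delta>"
      using sum_bounded_above[of "{..<Suc k}" "\<lambda>j. \<bar>a j - cf qs j\<bar>" \<delta>] cf by force
    have close: "norm (u - d m) + B * (\<Sum>j<Suc k. \<bar>a j - cf qs j\<bar>) \<le> r / 3"
    proof -
      have "norm (u - d m) + B * (\<Sum>j<Suc k. \<bar>a j - cf qs j\<bar>) \<le> \<delta> + B * (real (Suc k) * \<delta>)"
        using m sumS B_nonneg by (intro add_mono mult_left_mono) auto
      also have "\<dots> = \<delta> * (1 + B * real (Suc k))" by (simp add: algebra_simps)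
      finally show ?thesis using \<delta>(2) by simp
    qed
    have lim_close: "\<bar>nrm (Suc k) a u - L (k, qs, m)\<bar> \<le> r / 3"
      using nrm_Lipschitz[of "Suc k" a u "cf qs" "d m"] close by (simp add: L_def)
    have seq_close: "\<bar>nrm k (\<lambda>j. a (Suc j)) (u + a 0 *\<^sub>R y (\<iota> n)) - g (k, qs, m) (\<iota> n)\<bar> \<le> r / 3" for n
    proof -
      have "\<bar>nrm k (\<lambda>j. a (Suc j)) (u + a 0 *\<^sub>R y (\<iota> n)) - g (k, qs, m) (\<iota> n)\<bar>
        \<le> norm ((u + a 0 *\<^sub>R y (\<iota> n)) - (d m + cf qs 0 *\<^sub>R y (\<iota> n))) + B * (\<Sum>j<k. \<bar>a (Suc j) - cf qs (Suc j)\<bar>)"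
        using nrm_Lipschitz by (simp add: g_def)
      also have "(u + a 0 *\<^sub>R y (\<iota> n)) - (d m + cf qs 0 *\<^sub>R y (\<iota> n)) = (u - d m) + (a 0 - cf qs 0) *\<^sub>R y (\<iota> n)"
        by (simp add: algebra_simps)
      also have "norm \<dots> \<le> norm (u - d m) + \<bar>a 0 - cf qs 0\<bar> * B"
        using norm_triangle_ineq[of "u - d m" "(a 0 - cf qs 0) *\<^sub>R y (\<iota> n)"]
          mult_left_mono[OF \<iota>(2)[of n] abs_ge_zero[of "a 0 - cf qs 0"]] by simp
      finally show ?thesis using close unfolding sum_lessThan_Suc_head by (simp add: algebra_simps)
    qed
    obtain N where N: "\<And>n. n \<ge> N \<Longrightarrow> \<bar>g (k, qs, m) (\<iota> n) - L (k, qs, m)\<bar> < r / 3"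
      using LIMSEQ_D[OF test[of "(k, qs, m)"], of "r / 3"] r by auto
    show "\<exists>no. \<forall>n\<ge>no. norm (nrm k (\<lambda>j. a (Suc j)) (u + a 0 *\<^sub>R y (\<iota> n)) - nrm (Suc k) a u) < r"
    proof (intro exI allI impI)
      fix n assume "n \<ge> N"
      from N[OF this] lim_close seq_close[of n]
      show "norm (nrm k (\<lambda>j. a (Suc j)) (u + a 0 *\<^sub>R y (\<iota> n)) - nrm (Suc k) a u) < r"
        unfolding real_norm_def by linarith
    qed
  qed
  with \<iota>(1) show ?thesis by (rule that)
qed

text \<open>One-step limits suffice for iterated ones: a fixed prefix \<open>p\<close> supplies the
  offset, and the remaining coefficients are shifted by its length.\<close>

lemma itlim_nrm:
  assumes z: "\<And>k a u. (\<lambda>n. nrm k (\<lambda>j. a (Suc j)) (u + a 0 *\<^sub>R z n)) \<longlonglongrightarrow> nrm (Suc k) a u"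
  shows "itlim k (\<lambda>p. norm (\<Sum>j<length p. a j *\<^sub>R z (p ! j))) p
    (nrm k (\<lambda>j. a (length p + j)) (\<Sum>j<length p. a j *\<^sub>R z (p ! j)))"
proof (induction k arbitrary: p)
  case (Suc k)
  have "(\<Sum>j<length (p @ [n]). a j *\<^sub>R z ((p @ [n]) ! j))
      = (\<Sum>j<length p. a j *\<^sub>R z (p ! j)) + a (length p) *\<^sub>R z n" for n
    by (simp add: nth_append)
  then have "itlim k (\<lambda>p. norm (\<Sum>j<length p. a j *\<^sub>R z (p ! j))) (p @ [n])
      (nrm k (\<lambda>j. a (length p + Suc j)) ((\<Sum>j<length p. a j *\<^sub>R z (p ! j)) + a (length p + 0) *\<^sub>R z n))" for n
    using Suc.IH[of "p @ [n]"] by simp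
  moreover note z[of k "\<lambda>j. a (length p + j)" "\<Sum>j<length p. a j *\<^sub>R z (p ! j)"]
  ultimately show ?case unfolding itlim.simps
    by (intro exI[of _ "\<lambda>n. nrm k (\<lambda>j. a (length p + Suc j))
        ((\<Sum>j<length p. a j *\<^sub>R z (p ! j)) + a (length p + 0) *\<^sub>R z n)"] conjI always_eventually) auto
qed simp

end

text \<open>Asymptotic norms do not see null perturbations. This permits normalising a family whose
  norms converge to \<open>c\<close>.\<close>

lemma nrm_perturb:
  assumes "bounded_along V y B" "bounded_along V y' B'"
    and lim: "((\<lambda>i. y i - c *\<^sub>R y' i) \<longlongrightarrow> 0) V"
  shows "asym_norm V y k a u = asym_norm V y' k (\<lambda>j. c * a j) u"
proof (induction k arbitrary: a u)
  case (Suc k)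
  interpret Y: bounded_along V y B by fact
  interpret Y': bounded_along V y' B' by fact
  have "((\<lambda>i. asym_norm V y' k (\<lambda>j. c * a (Suc j)) (u + a 0 *\<^sub>R y i)
        - asym_norm V y' k (\<lambda>j. c * a (Suc j)) (u + (c * a 0) *\<^sub>R y' i)) \<longlongrightarrow> 0) V"
  proof (rule Lim_null_comparison)
    have "norm (asym_norm V y' k (\<lambda>j. c * a (Suc j)) (u + a 0 *\<^sub>R y i)
        - asym_norm V y' k (\<lambda>j. c * a (Suc j)) (u + (c * a 0) *\<^sub>R y' i)) \<le> norm (a 0 *\<^sub>R (y i - c *\<^sub>R y' i))" for i
      using Y'.nrm_Lipschitz[of k "\<lambda>j. c * a (Suc j)" "u + a 0 *\<^sub>R y i" "\<lambda>j. c * a (Suc j)" "u + (c * a 0) *\<^sub>R y' i"]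
      by (simp add: algebra_simps)
    then show "\<forall>\<^sub>F i in V. norm (asym_norm V y' k (\<lambda>j. c * a (Suc j)) (u + a 0 *\<^sub>R y i)
        - asym_norm V y' k (\<lambda>j. c * a (Suc j)) (u + (c * a 0) *\<^sub>R y' i)) \<le> norm (a 0 *\<^sub>R (y i - c *\<^sub>R y' i))"
      by simp
    show "((\<lambda>i. norm (a 0 *\<^sub>R (y i - c *\<^sub>R y' i))) \<longlongrightarrow> 0) V"
      using tendsto_norm[OF tendsto_scaleR[OF tendsto_const[of "a 0"] lim]] by simp
  qed
  from tendsto_add[OF this Y'.nrm_tendsto[of k "\<lambda>j. c * a j" u]]
  have "((\<lambda>i. asym_norm V y k (\<lambda>j. a (Suc j)) (u + a 0 *\<^sub>R y i)) \<longlongrightarrow> asym_norm V y' (Suc k) (\<lambda>j. c * a j) u) V"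
    by (simp add: Suc.IH)
  with Y.nrm_tendsto show ?case by (rule tendsto_unique[OF Y.not_bot])
qed simp

section \<open>Differences of weakly Cauchy sequences\<close>

definition weakly_Cauchy :: "(nat \<Rightarrow> 'a::real_normed_vector) \<Rightarrow> bool" where
  "weakly_Cauchy x \<longleftrightarrow> (\<forall>h :: 'a \<Rightarrow>\<^sub>L real. convergent (\<lambda>n. blinfun_apply h (x n)))"

lemma weakly_CauchyD:
  assumes "weakly_Cauchy x" "bounded_linear (h :: _ \<Rightarrow> real)"
  shows "convergent (\<lambda>n. h (x n))"
  using assms(1)[unfolded weakly_Cauchy_def, THEN spec[where x = "Blinfun h"]]
  by (simp add: bounded_linear_Blinfun_apply[OF assms(2)])

text \<open>If no \<open>k\<close> worked, constant coefficients would satisfy a linear lower bound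
  for every \<open>k\<close>, which \<open>nrm_ge\<close> extends to all coefficients. The
  normalised differences would then yield a normalized weakly null sequence with an l1 spreading
  model.\<close>

lemma asym_norm_differences_small:
  fixes x :: "nat \<Rightarrow> 'a::real_normed_vector"
  assumes sep: "\<And>x e. 0 < e \<Longrightarrow> \<exists>n. norm (x - (d :: nat \<Rightarrow> 'a) n) < e"
    and no_l1_sm: "\<And>(x :: nat \<Rightarrow> 'a) N. (\<forall>n. norm (x n) = 1) \<Longrightarrow> weakly_null x \<Longrightarrow>
                      generates_spreading_model x N \<Longrightarrow> \<not> sm_equiv_l1 N"
    and U: "ultra U" "U \<le> sequentially"
    and bdd: "\<And>n. norm (x n) \<le> R" and wc: "weakly_Cauchy x" and e: "0 < e"
  obtains k where "0 < k" "asym_norm (pair_filter U) (\<lambda>(p, q). x p - x q) k (\<lambda>_. 1) 0 < e * real k"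
proof (rule ccontr)
  assume "\<not> thesis"
  define V where "V = pair_filter U"
  define y where "y = (\<lambda>(p, q). x p - x q)"
  \<comment> \<open>Where \<open>y\<close> vanishes so does \<open>y'\<close>, because
    \<open>1 / 0 = 0\<close>; the bound 1 on its norm thus holds everywhere.\<close>
  define y' where "y' = (\<lambda>i. (1 / norm (y i)) *\<^sub>R y i)"
  have V: "ultra V" unfolding V_def using U(1) by (rule ultra_pair_filter)
  have "norm (y i) \<le> R + R" for i
    using norm_triangle_ineq4[of "x (fst i)" "x (snd i)"] bdd[of "fst i"] bdd[of "snd i"]
    by (simp add: y_def case_prod_beta)
  then interpret Y: bounded_along V y "R + R"
    by unfold_locales (auto intro: V)
  interpret Y': bounded_along V y' 1
    by unfold_locales (auto intro: V simp: y'_def)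
  have ones: "e * real k \<le> Y.nrm k (\<lambda>_. 1) 0" for k
    proof (cases "k = 0")
    case False
    then show ?thesis using that[of k] \<open>\<not> thesis\<close> unfolding V_def y_def by force
  qed simp
  \<comment> \<open>\<open>c\<close> is the limit of \<open>norm (y i)\<close>; the assumed lower
    bound at length 1 gives \<open>e \<le> c\<close>, so normalising is harmless along
    \<open>V\<close>.\<close>
  define c where "c = Y.nrm 1 (\<lambda>_. 1) 0"
  have c: "e \<le> c" "0 < c" using ones[of 1] e by (auto simp: c_def)
  have norm_y: "((\<lambda>i. norm (y i)) \<longlongrightarrow> c) V"
    using Y.nrm_tendsto[of 0 "\<lambda>_. 1" 0] by (simp add: c_def)
  have big: "eventually (\<lambda>i. e / 2 < norm (y i)) V"
    using order_tendstoD(1)[OF norm_y, of "e / 2"] c e by simp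
  have tail: "eventually (\<lambda>i. N \<le> fst i \<and> N \<le> snd i) V" for N
  proof -
    have "eventually (\<lambda>p. N \<le> p) U" using U(2) eventually_ge_at_top filter_leD by blast
    then have "\<forall>\<^sub>F p in U. N \<le> p \<and> (\<forall>\<^sub>F q in U. N \<le> q)" by (auto intro: eventually_conj)
    then show ?thesis unfolding V_def eventually_pair_filter
      by eventually_elim (auto elim: eventually_mono)
  qed
  \<comment> \<open>Stated with a threshold on the indices, because it serves both the limit along
    \<open>V\<close> and the extracted sequence, whose convergence is not along
    \<open>V\<close>.\<close>
  have small: "\<exists>N. \<forall>p\<ge>N. \<forall>q\<ge>N. e / 2 < norm (y (p, q)) \<longrightarrow> \<bar>h (y' (p, q))\<bar> < r"
    if h: "bounded_linear h" and r: "0 < r" for h and r :: real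
  proof -
    have "Cauchy (\<lambda>n. h (x n))" using weakly_CauchyD[OF wc h] by (rule convergent_Cauchy)
    then obtain N where N: "\<And>p q. p \<ge> N \<Longrightarrow> q \<ge> N \<Longrightarrow> dist (h (x p)) (h (x q)) < r * (e / 2)"
      using r e by (meson metric_CauchyD half_gt_zero mult_pos_pos)
    have "\<bar>h (y' (p, q))\<bar> < r" if "p \<ge> N" "q \<ge> N" "e / 2 < norm (y (p, q))" for p q
    proof -
      have "\<bar>h (y (p, q))\<bar> < r * (e / 2)"
        using N[OF that(1,2)] linear_diff[OF bounded_linear.linear[OF h]]
        by (simp add: y_def dist_real_def)
      also have "\<dots> < r * norm (y (p, q))" using that(3) r by simp
      finally have "\<bar>h (y (p, q))\<bar> / norm (y (p, q)) < r"
        using that(3) e r by (simp add: divide_less_eq)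
      then show ?thesis using linear_cmul[OF bounded_linear.linear[OF h]]
        by (simp add: y'_def abs_mult)
    qed
    then show ?thesis by blast
  qed
  have weak: "((\<lambda>i. h (y' i)) \<longlongrightarrow> (0::real)) V" if h: "bounded_linear h" for h
  proof (rule tendstoI)
    fix r :: real assume "0 < r"
    then obtain N where N: "\<And>p q. p \<ge> N \<Longrightarrow> q \<ge> N \<Longrightarrow> e / 2 < norm (y (p, q)) \<Longrightarrow> \<bar>h (y' (p, q))\<bar> < r"
      using small[OF h] by blast
    show "\<forall>\<^sub>F i in V. dist (h (y' i)) 0 < r"
      using big tail[of N] by eventually_elim (use N in \<open>auto simp: dist_real_def\<close>)
  qed
  have "((\<lambda>i. y i - c *\<^sub>R y' i) \<longlongrightarrow> 0) V"
  proof (rule Lim_null_comparison)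
    have "norm (y i - c *\<^sub>R y' i) \<le> \<bar>norm (y i) - c\<bar>" for i
    proof (cases "y i = 0")
      case False
      then have "y i - c *\<^sub>R y' i = ((norm (y i) - c) / norm (y i)) *\<^sub>R y i"
        by (simp add: y'_def diff_divide_distrib scaleR_left_diff_distrib)
      then show ?thesis using False by simp
    qed (simp add: y'_def)
    then show "\<forall>\<^sub>F i in V. norm (y i - c *\<^sub>R y' i) \<le> \<bar>norm (y i) - c\<bar>" by simp
    show "((\<lambda>i. \<bar>norm (y i) - c\<bar>) \<longlongrightarrow> 0) V"
      using tendsto_rabs[OF tendsto_diff[OF norm_y tendsto_const[of c]]] by simp
  qed
  note perturb = nrm_perturb[OF Y.bounded_along_axioms Y'.bounded_along_axioms this]
  have "e / c * real k \<le> Y'.nrm k (\<lambda>_. 1) 0" for k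
  proof -
    have "Y'.nrm k (\<lambda>_. 1) 0 = Y.nrm k (\<lambda>_. 1 / c * 1) ((1 / c) *\<^sub>R 0)"
      using perturb[of k "\<lambda>_. 1 / c" 0] c by simp
    also have "\<dots> = 1 / c * Y.nrm k (\<lambda>_. 1) 0"
      using c by (subst Y.nrm_scale) simp
    also have "\<dots> \<ge> 1 / c * (e * real k)"
      using c ones[of k] by (intro mult_left_mono) auto
    finally show ?thesis by simp
  qed
  note lower = Y'.nrm_ge[OF weak this]
  \<comment> \<open>These conditions accompany the extraction: nonzero norms make \<open>z\<close>
    normalised, and indices beyond \<open>n\<close> make it weakly null.\<close>
  have ev: "eventually (\<lambda>i. e / 2 < norm (y i) \<and> n \<le> fst i \<and> n \<le> snd i) V" for n
    by (rule eventually_conj[OF big tail])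
  obtain \<iota> where \<iota>: "\<And>n. e / 2 < norm (y (\<iota> n)) \<and> n \<le> fst (\<iota> n) \<and> n \<le> snd (\<iota> n)"
    and lim: "\<And>k a u. (\<lambda>n. Y'.nrm k (\<lambda>j. a (Suc j)) (u + a 0 *\<^sub>R y' (\<iota> n))) \<longlonglongrightarrow> Y'.nrm (Suc k) a u"
  proof (rule Y'.nrm_realising_sequence[of d "\<lambda>n i. e / 2 < norm (y i) \<and> n \<le> fst i \<and> n \<le> snd i", OF sep ev])
    fix \<iota> assume \<iota>: "\<And>n. e / 2 < norm (y (\<iota> n)) \<and> n \<le> fst (\<iota> n) \<and> n \<le> snd (\<iota> n)"
      "\<And>k a u. (\<lambda>n. Y'.nrm k (\<lambda>j. a (Suc j)) (u + a 0 *\<^sub>R y' (\<iota> n))) \<longlonglongrightarrow> Y'.nrm (Suc k) a u"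
    show thesis by (rule that[of \<iota>]) (fact \<iota>)+
  qed
  define z where "z = (\<lambda>n. y' (\<iota> n))"
  have "norm (z n) = 1" for n using \<iota>[of n] e by (auto simp: z_def y'_def)
  moreover have "weakly_null z"
    unfolding weakly_null_def
  proof (intro allI LIMSEQ_I)
    fix h :: "'a \<Rightarrow>\<^sub>L real" and r :: real assume "0 < r"
    then obtain N where N: "\<And>p q. p \<ge> N \<Longrightarrow> q \<ge> N \<Longrightarrow> e / 2 < norm (y (p, q)) \<Longrightarrow> \<bar>h (y' (p, q))\<bar> < r"
      using small[OF blinfun.bounded_linear_right] by blast
    have "norm (h (z n) - 0) < r" if "n \<ge> N" for n
      using N[of "fst (\<iota> n)" "snd (\<iota> n)"] \<iota>[of n] that by (simp add: z_def)
    then show "\<exists>no. \<forall>n\<ge>no. norm (h (z n) - 0) < r" by blast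
  qed
  moreover have "generates_spreading_model z (\<lambda>k a. Y'.nrm k a 0)"
    unfolding generates_spreading_model_def
  proof (intro allI)
    fix k a
    have "(\<lambda>n. Y'.nrm k (\<lambda>j. a (Suc j)) (u + a 0 *\<^sub>R z n)) \<longlonglongrightarrow> Y'.nrm (Suc k) a u" for k a u
      unfolding z_def by (rule lim)
    from Y'.itlim_nrm[OF this, of k a "[]"]
    show "itlim k (\<lambda>p. norm (\<Sum>j<length p. a j *\<^sub>R z (p ! j))) [] (Y'.nrm k a 0)" by simp
  qed
  moreover have "sm_equiv_l1 (\<lambda>k a. Y'.nrm k a 0)"
    unfolding sm_equiv_l1_def
  proof (intro exI conjI allI)
    show "0 < e / c / 2" using e c by simp
    show "e / c / 2 * (\<Sum>j<k. \<bar>a j\<bar>) \<le> Y'.nrm k a 0" for k a by (rule lower)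
    show "Y'.nrm k a 0 \<le> 1 * (\<Sum>j<k. \<bar>a j\<bar>)" for k a using Y'.nrm_le[of k a 0] by simp
  qed
  ultimately show False using no_l1_sm by blast
qed

subsection \<open>Rosenthal's theorem\<close>

text \<open>Greedy choice: each new term meets the requirements of all words over the earlier terms.
  Bounding the length of the words leaves finitely many requirements, and increasing selections
  respect the bound.\<close>

lemma ultrafilter_fusion:
  assumes U: "ultra U" "U \<le> sequentially" and A: "\<And>t. eventually (A t) U"
  obtains n :: "nat \<Rightarrow> nat" where "strict_mono n"
    and "\<forall>js m. sorted_wrt (<) js \<and> (\<forall>j\<in>set js. j < m) \<longrightarrow> A (map n js) (n m)"
proof -
  define next_ok where "next_ok L m \<longleftrightarrow> (\<forall>l\<in>set L. l < m) \<and> (\<forall>t\<in>{t. set t \<subseteq> set L \<and> length t \<le> length L}. A t m)" for L m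
  have "eventually (next_ok L) U" for L
  proof -
    have "eventually (\<lambda>m. l < m) U" for l
      using U(2) eventually_gt_at_top filter_leD by blast
    then show ?thesis unfolding next_ok_def
      by (intro eventually_conj eventually_ball_finite ballI finite_lists_length_le A) auto
  qed
  then have "\<exists>m. next_ok L m" for L
    using eventually_happens ultra_not_bot[OF U(1)] by blast
  then obtain c where c: "\<And>L. next_ok L (c L)" by metis
  define L where "L = rec_nat [] (\<lambda>_ l. l @ [c l])"
  define n where "n = (\<lambda>m. c (L m))"
  have L_eq: "L m = map n [0..<m]" for m
    by (induction m) (auto simp: L_def n_def)
  have "strict_mono n"
    unfolding strict_mono_Suc_iff
  proof
    fix m
    have "n m \<in> set (L (Suc m))" by (simp add: L_eq)
    then show "n m < n (Suc m)" using c[of "L (Suc m)"] by (auto simp: next_ok_def n_def)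
  qed
  moreover have "A (map n js) (n m)" if "sorted_wrt (<) js" "\<And>j. j \<in> set js \<Longrightarrow> j < m" for js m
  proof -
    have "distinct js" using that(1) by (simp add: strict_sorted_iff)
    then have "length js = card (set js)" by (simp add: distinct_card)
    also have "\<dots> \<le> card {..<m}" using that(2) by (intro card_mono) auto
    finally have "length (map n js) \<le> length (L m)" by (simp add: L_eq)
    moreover have "set (map n js) \<subseteq> set (L m)" using that(2) by (auto simp: L_eq)
    ultimately have "map n js \<in> {t. set t \<subseteq> set (L m) \<and> length t \<le> length (L m)}" by blast
    then show ?thesis using c[of "L m"] by (auto simp: next_ok_def n_def)
  qed
  ultimately show ?thesis by (intro that[of n]) auto
qed

section \<open>Unavoidable sets of finite words\<close>

lemma eventually_imp_mono: "(\<And>x. P x \<longrightarrow> Q x) \<Longrightarrow> eventually P F \<longrightarrow> eventually Q F"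
  by (auto elim: eventually_mono)

text \<open>The least fixed point expresses that continuing \<open>t\<close> by suitable
  \<open>U\<close>-large choices leads to \<open>bad\<close> after finitely many steps, with no
  uniform bound on their number.\<close>

inductive unavoidable :: "nat filter \<Rightarrow> (nat list \<Rightarrow> bool) \<Rightarrow> nat list \<Rightarrow> bool" for U bad where
  bad: "bad t \<Longrightarrow> unavoidable U bad t"
| step: "(\<forall>\<^sub>F m in U. unavoidable U bad (t @ [m])) \<Longrightarrow> unavoidable U bad t"
  monos eventually_imp_mono

text \<open>The derivation is turned into requirements on the next term in dependence on the
  history; every infinite sequence that obeys them meets \<open>bad\<close>.\<close>

lemma unavoidable_strategy:
  assumes "unavoidable U bad s"
  shows "\<exists>A. (\<forall>t. eventually (A t) U) \<and>
    (\<forall>n. (\<forall>i. A (map n [0..<i]) (n i)) \<longrightarrow> (\<exists>i. bad (s @ map n [0..<i])))"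
  using assms
proof induction
  case (bad t)
  then show ?case by (intro exI[of _ "\<lambda>_ _. True"]) (auto intro: exI[of _ 0])
next
  case (step t)
  define W where "W = (\<lambda>m A. (\<forall>t. eventually (A t) U) \<and>
    (\<forall>n. (\<forall>i. A (map n [0..<i]) (n i)) \<longrightarrow> (\<exists>i. bad ((t @ [m]) @ map n [0..<i]))))"
  define good where "good = {m. \<exists>A. W m A}"
  have good: "eventually (\<lambda>m. m \<in> good) U"
    using step.IH by eventually_elim (auto simp: good_def W_def)
  obtain A where A: "\<And>m. m \<in> good \<Longrightarrow> W m (A m)"
  proof -
    have "\<forall>m\<in>good. \<exists>A. W m A" by (simp add: good_def)
    then show thesis using that by metis
  qed
  \<comment> \<open>The strategies for the one-step extensions are glued: the first letter of the
    history selects which one to follow. The trivial requirement after a first letter outside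
    \<open>good\<close> keeps every \<open>A' l\<close> large.\<close>
  define A' where "A' = (\<lambda>l. case l of [] \<Rightarrow> (\<lambda>m. m \<in> good) | m # l' \<Rightarrow> if m \<in> good then A m l' else (\<lambda>_. True))"
  have "eventually (A' l) U" for l
    using good A by (cases l) (auto simp: A'_def W_def)
  moreover have "\<exists>i. bad (t @ map n [0..<i])" if n: "\<forall>i. A' (map n [0..<i]) (n i)" for n
  proof -
    have g: "n 0 \<in> good" using n[rule_format, of 0] by (simp add: A'_def)
    have shift: "map n [0..<Suc i] = n 0 # map (\<lambda>j. n (Suc j)) [0..<i]" for i
      by (simp only: upt_conv_Cons zero_less_Suc map_Suc_upt[symmetric]) simp
    have "A (n 0) (map (\<lambda>j. n (Suc j)) [0..<i]) (n (Suc i))" for i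
      using n[rule_format, of "Suc i"] g unfolding shift by (simp add: A'_def)
    then obtain i where "bad ((t @ [n 0]) @ map (\<lambda>j. n (Suc j)) [0..<i])"
      using A[OF g] unfolding W_def by metis
    then have "bad (t @ map n [0..<Suc i])" unfolding shift by simp
    then show ?thesis by blast
  qed
  ultimately show ?case by blast
qed

text \<open>The ultrafilter replaces the Nash-Williams partition theorem for the closed family of sequences
  avoiding \<open>bad\<close>.\<close>
lemma avoiding_subsequence:
  assumes U: "ultra U" "U \<le> sequentially"
    and avoid: "\<And>n :: nat \<Rightarrow> nat. strict_mono n \<Longrightarrow> \<exists>g :: nat \<Rightarrow> nat. strict_mono g \<and> (\<forall>i. \<not> bad (map (n \<circ> g) [0..<i]))"
  obtains n :: "nat \<Rightarrow> nat" where "strict_mono n" "\<forall>js. sorted_wrt (<) js \<longrightarrow> \<not> bad (map n js)"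
proof (cases "unavoidable U bad []")
  case True
  then obtain A where A: "\<And>t. eventually (A t) U"
      "\<And>n. (\<And>i. A (map n [0..<i]) (n i)) \<Longrightarrow> \<exists>i. bad (map n [0..<i])"
    using unavoidable_strategy by (metis append_Nil)
  obtain n :: "nat \<Rightarrow> nat" where n: "strict_mono n"
      "\<forall>js m. sorted_wrt (<) js \<and> (\<forall>j\<in>set js. j < m) \<longrightarrow> A (map n js) (n m)"
    by (rule ultrafilter_fusion[of U A, OF U A(1)]) (rule that)
  obtain g :: "nat \<Rightarrow> nat" where g: "strict_mono g" "\<And>i. \<not> bad (map (n \<circ> g) [0..<i])"
    using avoid[OF n(1)] by blast
  \<comment> \<open>Fusion covers all increasing selections, so the subsequence obeys the strategy
    as well and must meet \<open>bad\<close>, against the choice of \<open>g\<close>.\<close>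
  have "A (map (n \<circ> g) [0..<i]) ((n \<circ> g) i)" for i
  proof -
    have "A (map n (map g [0..<i])) (n (g i))"
      using g(1) by (intro n(2)[rule_format]) (auto simp: sorted_wrt_map strict_mono_def intro: sorted_wrt_mono_rel[OF _ sorted_wrt_upt])
    then show ?thesis by simp
  qed
  then show ?thesis using A(2) g(2) by blast
next
  case False
  \<comment> \<open>If \<open>t\<close> is not unavoidable, the set of \<open>m\<close> for which
    \<open>t @ [m]\<close> is unavoidable is not \<open>U\<close>-large; as \<open>U\<close> is an
    ultrafilter, its complement is.\<close>
  have ev: "eventually (\<lambda>m. \<not> unavoidable U bad t \<longrightarrow> \<not> unavoidable U bad (t @ [m])) U" for t
    using U(1) unavoidable.step[of U bad t] by (auto simp: ultra_def)
  obtain n :: "nat \<Rightarrow> nat" where n: "strict_mono n"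
    "\<forall>js m. sorted_wrt (<) js \<and> (\<forall>j\<in>set js. j < m) \<longrightarrow>
       \<not> unavoidable U bad (map n js) \<longrightarrow> \<not> unavoidable U bad (map n js @ [n m])"
    by (rule ultrafilter_fusion[of U "\<lambda>t m. \<not> unavoidable U bad t \<longrightarrow> \<not> unavoidable U bad (t @ [m])", OF U ev])
       (rule that)
  have "\<not> unavoidable U bad (map n js)" if "sorted_wrt (<) js" for js
    using that
  proof (induction js rule: rev_induct)
    case (snoc m js)
    then show ?case using n(2)[rule_format, of js m] by (auto simp: sorted_wrt_append)
  qed (use False in simp)
  then have "\<forall>js. sorted_wrt (<) js \<longrightarrow> \<not> bad (map n js)"
    using unavoidable.bad by blast
  with n(1) show ?thesis by (rule that)
qed

section \<open>Oscillation and independence\<close>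

lemma strict_mono_infinitely_often:
  assumes "\<And>i. \<exists>\<^sub>F n in sequentially. P i n"
  obtains g :: "nat \<Rightarrow> nat" where "strict_mono g" "\<And>i. P i (g i)"
proof -
  have "\<exists>n>m. P i n" for i m
    using assms[of i] unfolding frequently_sequentially by (meson Suc_le_eq)
  then have "m < (SOME n. m < n \<and> P i n) \<and> P i (SOME n. m < n \<and> P i n)" for i m
    by (rule someI_ex)
  moreover define c where "c i m = (SOME n. m < n \<and> P i n)" for i m
  ultimately have c: "m < c i m" "P i (c i m)" for i m by auto
  define g where "g = rec_nat (c 0 0) (\<lambda>i m. c (Suc i) m)"
  have "strict_mono g" by (simp add: strict_mono_Suc_iff g_def c)
  moreover have "P i (g i)" for i by (cases i) (simp_all add: g_def c)
  ultimately show ?thesis by (rule that)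
qed

definition oscillates :: "(nat \<Rightarrow> 'a::real_normed_vector) \<Rightarrow> real \<Rightarrow> real \<Rightarrow> (nat \<Rightarrow> nat) \<Rightarrow> bool" where
  "oscillates x r q n \<longleftrightarrow> (\<exists>h :: 'a \<Rightarrow>\<^sub>L real. norm h \<le> 1 \<and>
     (\<exists>\<^sub>F i in sequentially. blinfun_apply h (x (n i)) < r) \<and> (\<exists>\<^sub>F i in sequentially. q < blinfun_apply h (x (n i))))"

text \<open>A functional that diverges along the sequence has \<open>liminf < limsup\<close>, and
  two levels fit in between. They are taken rational so that a diagonal argument can enumerate
  them.\<close>

lemma not_weakly_Cauchy_oscillates:
  assumes bdd: "\<And>n. norm (x n) \<le> R" and nwc: "\<not> weakly_Cauchy (x \<circ> n)"
  obtains r q :: rat where "r < q" "oscillates x (of_rat r) (of_rat q) n"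
proof -
  obtain h0 :: "_ \<Rightarrow>\<^sub>L real" where h0: "\<not> convergent (\<lambda>i. h0 (x (n i)))"
    using nwc by (auto simp: weakly_Cauchy_def)
  define h where "h = (1 / norm h0) *\<^sub>R h0"
  have "h0 \<noteq> 0" using h0 by (auto simp: convergent_const)
  then have h: "norm h \<le> 1" "\<And>v. h0 v = norm h0 * h v" by (simp_all add: h_def blinfun.scaleR_left)
  have nc: "\<not> convergent (\<lambda>i. blinfun_apply h (x (n i)))"
  proof
    assume "convergent (\<lambda>i. blinfun_apply h (x (n i)))"
    then have "convergent (\<lambda>i. norm h0 * blinfun_apply h (x (n i)))"
      by (intro convergent_mult convergent_const)
    with h0 show False by (simp add: h(2))
  qed
  have "\<bar>blinfun_apply h (x m)\<bar> \<le> R" for m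
    using norm_blinfun[of h "x m"] h(1) bdd[of m] mult_mono[of "norm h" 1 "norm (x m)" R]
    by (simp add: order_trans[OF norm_ge_zero])
  define b where "b = (\<lambda>i. blinfun_apply h (x (n i)))"
  have bR: "\<bar>b i\<bar> \<le> R" for i using \<open>\<And>m. \<bar>blinfun_apply h (x m)\<bar> \<le> R\<close> by (simp add: b_def)
  define f where "f = (\<lambda>i. ereal (b i))"
  have lt: "liminf f < limsup f"
  proof (rule ccontr)
    assume "\<not> liminf f < limsup f"
    then have eq: "liminf f = limsup f"
      by (meson Liminf_le_Limsup antisym_conv2 sequentially_bot trivial_limit_sequentially)
    then have "f \<longlonglongrightarrow> limsup f" by (simp add: limsup_le_liminf_real tendsto_iff_Liminf_eq_Limsup)
    moreover have "\<bar>limsup f\<bar> \<noteq> \<infinity>"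
    proof -
      have "limsup f \<le> ereal R"
        by (rule Limsup_bounded) (use bR in \<open>auto simp: f_def abs_le_iff\<close>)
      moreover have "ereal (- R) \<le> liminf f"
        by (rule Liminf_bounded) (use bR in \<open>auto simp: f_def abs_le_iff minus_le_iff\<close>)
      ultimately show ?thesis using eq by auto
    qed
    ultimately obtain l where "(\<lambda>i. ereal (b i)) \<longlonglongrightarrow> ereal l"
      unfolding f_def by (metis ereal_real')
    then have "b \<longlonglongrightarrow> l" by simp
    then show False using nc by (auto simp: b_def convergent_def)
  qed
  obtain c where c: "liminf f < ereal c" "ereal c < limsup f"
    using lt by (metis ereal_dense2 )
  obtain e where e: "ereal c < ereal e" "ereal e < limsup f"
    using ereal_dense2[OF c(2)] by auto
  obtain r where r: "c < of_rat r" "of_rat r < e" using of_rat_dense[of c e] e(1) by auto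
  obtain q where q: "of_rat r < (of_rat q :: real)" "of_rat q < e" using of_rat_dense[OF r(2)] by auto
  have low: "\<exists>\<^sub>F i in sequentially. b i < of_rat r"
  proof (rule ccontr)
    assume "\<not> ?thesis"
    then have "\<forall>\<^sub>F i in sequentially. ereal (of_rat r) \<le> f i"
      by (simp add: not_frequently f_def not_less)
    then have "ereal (of_rat r) \<le> liminf f" by (rule Liminf_bounded)
    then show False using c(1) r(1) by (meson ereal_less_eq(3) less_le_trans not_less order.strict_implies_order)
  qed
  have high: "\<exists>\<^sub>F i in sequentially. of_rat q < b i"
  proof (rule ccontr)
    assume "\<not> ?thesis"
    then have "\<forall>\<^sub>F i in sequentially. f i \<le> ereal (of_rat q)"
      by (simp add: not_frequently f_def not_less)
    then have "limsup f \<le> ereal (of_rat q)" by (rule Limsup_bounded)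
    then show False using e(2) q(2) by (meson ereal_less_eq(3) le_less_trans not_less order.strict_implies_order)
  qed
  have "r < q" using q(1) by (simp add: of_rat_less)
  moreover have "oscillates x (of_rat r) (of_rat q) n"
    unfolding oscillates_def using h(1) low high by (auto simp: b_def)
  ultimately show ?thesis by (rule that)
qed

lemma oscillates_subseq:
  assumes "strict_mono n" "oscillates x r q (s \<circ> n)"
  shows "oscillates x r q s"
proof -
  have "\<exists>\<^sub>F i in sequentially. P (s i)" if "\<exists>\<^sub>F i in sequentially. P ((s \<circ> n) i)" for P
    using that seq_suble[OF assms(1)] unfolding frequently_sequentially comp_def
    by (meson order_trans)
  from this[of "\<lambda>i. blinfun_apply _ (x i) < r"] this[of "\<lambda>i. q < blinfun_apply _ (x i)"] assms(2)
  show ?thesis unfolding oscillates_def by blast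
qed

text \<open>A diagonal sequence belongs to a given stage only from some index on; oscillation
  survives this cut.\<close>

lemma oscillates_shift:
  assumes "oscillates x r q s"
  shows "oscillates x r q (s \<circ> (+) m)"
proof -
  have "\<exists>\<^sub>F i in sequentially. P ((s \<circ> (+) m) i)" if fr: "\<exists>\<^sub>F i in sequentially. P (s i)" for P
    unfolding frequently_sequentially
  proof
    fix N
    obtain i where "i \<ge> m + N" "P (s i)" using fr[unfolded frequently_sequentially, THEN spec[of _ "m + N"]] by (elim exE conjE)
    then show "\<exists>j\<ge>N. P ((s \<circ> (+) m) j)" by (intro exI[of _ "i - m"]) auto
  qed
  from this[of "\<lambda>i. blinfun_apply _ (x i) < r"] this[of "\<lambda>i. q < blinfun_apply _ (x i)"] assms
  show ?thesis unfolding oscillates_def by blast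
qed

text \<open>Otherwise every pair of levels could be destroyed by passing to a further subsequence.
  The diagonal subsequence would then oscillate between no two rationals and be weakly
  Cauchy.\<close>

lemma hereditary_oscillation:
  assumes bdd: "\<And>n. norm (x n) \<le> R" and nwc: "\<And>n. strict_mono n \<Longrightarrow> \<not> weakly_Cauchy (x \<circ> n)"
  obtains r q :: real and s :: "nat \<Rightarrow> nat"
    where "r < q" "strict_mono s" "\<forall>n. strict_mono n \<longrightarrow> oscillates x r q (s \<circ> n)"
proof (rule ccontr)
  assume neg: "\<not> thesis"
  define P where "P = (\<lambda>k s. (let (r, q) = (from_nat k :: rat \<times> rat) in
    r < q \<longrightarrow> \<not> oscillates x (of_rat r) (of_rat q) s))"
  interpret subseqs P
  proof
    fix k and s :: "nat \<Rightarrow> nat" assume s: "strict_mono s"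
    obtain r q where rq: "(from_nat k :: rat \<times> rat) = (r, q)" by fastforce
    have "\<exists>n. strict_mono n \<and> (r < q \<longrightarrow> \<not> oscillates x (of_rat r) (of_rat q) (s \<circ> n))"
    proof (cases "r < q")
      case True
      then show ?thesis using neg that[of "of_rat r" "of_rat q" s] s by (auto simp: of_rat_less)
    qed (auto intro: strict_mono_id)
    then show "\<exists>r'. strict_mono r' \<and> P k (s \<circ> r')" by (auto simp: P_def rq)
  qed
  obtain r q where rq: "r < q" "oscillates x (of_rat r) (of_rat q) diagseq"
    by (rule not_weakly_Cauchy_oscillates[OF bdd nwc[OF subseq_diagseq]]) (rule that)
  define k where "k = to_nat (r, q)"
  have "P k (s \<circ> n)" if "strict_mono n" "P k s" for k s n
    using that oscillates_subseq[OF that(1)] by (auto simp: P_def split: prod.splits)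
  then have "P k (diagseq \<circ> (+) (Suc k))" by (rule diagseq_holds)
  then have "\<not> oscillates x (of_rat r) (of_rat q) (diagseq \<circ> (+) (Suc k))"
    using rq(1) by (simp add: P_def k_def)
  then show False using oscillates_shift[OF rq(2)] by blast
qed

text \<open>Bad words are those along which no functional of the unit ball alternates between above
  \<open>q\<close> and below \<open>r\<close>. Oscillation produces an alternating subsequence of
  every sequence, so some \<open>n\<close> has no bad words at all. Alternation then encodes
  arbitrary patterns on sparse terms with spare neighbours.\<close>

lemma independent_subsequence:
  fixes x :: "nat \<Rightarrow> 'a::real_normed_vector"
  assumes U: "ultra U" "U \<le> sequentially"
    and osc: "\<And>n. strict_mono n \<Longrightarrow> oscillates x r q n"
  obtains s :: "nat \<Rightarrow> nat" where "strict_mono s"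
    and "\<forall>S K. \<exists>h :: 'a \<Rightarrow>\<^sub>L real. norm h \<le> 1 \<and> (\<forall>i<K. if i \<in> S then q < blinfun_apply h (x (s i)) else blinfun_apply h (x (s i)) < r)"
proof -
  define ok where "ok = (\<lambda>(h :: 'a \<Rightarrow>\<^sub>L real) (i :: nat) m. if even i then q < blinfun_apply h (x m) else blinfun_apply h (x m) < r)"
  define bad where "bad t \<longleftrightarrow> \<not> (\<exists>h. norm h \<le> 1 \<and> (\<forall>i<length t. ok h i (t ! i)))" for t :: "nat list"
  have avoid: "\<exists>g :: nat \<Rightarrow> nat. strict_mono g \<and> (\<forall>i. \<not> bad (map (n \<circ> g) [0..<i]))" if n: "strict_mono n" for n :: "nat \<Rightarrow> nat"
  proof -
    obtain h :: "'a \<Rightarrow>\<^sub>L real" where h: "norm h \<le> 1"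
      "\<exists>\<^sub>F i in sequentially. blinfun_apply h (x (n i)) < r" "\<exists>\<^sub>F i in sequentially. q < blinfun_apply h (x (n i))"
      using osc[OF n] unfolding oscillates_def by blast
    have "\<exists>\<^sub>F j in sequentially. ok h i (n j)" for i
      using h(2,3) by (cases "even i") (simp_all add: ok_def)
    then obtain g :: "nat \<Rightarrow> nat" where "strict_mono g" "\<And>i. ok h i (n (g i))"
      using strict_mono_infinitely_often[of "\<lambda>i j. ok h i (n j)"] by blast
    then show ?thesis using h(1) by (auto simp: bad_def)
  qed
  obtain n :: "nat \<Rightarrow> nat" where n: "strict_mono n" "\<forall>js. sorted_wrt (<) js \<longrightarrow> \<not> bad (map n js)"
    by (rule avoiding_subsequence[OF U], rule avoid, assumption) (rule that)
  define s where "s = (\<lambda>i. n (3 * i + 1))"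
  have "strict_mono s" using n(1) by (simp add: s_def strict_mono_def)
  moreover have "\<exists>h :: 'a \<Rightarrow>\<^sub>L real. norm h \<le> 1 \<and> (\<forall>i<K. if i \<in> S then q < blinfun_apply h (x (s i)) else blinfun_apply h (x (s i)) < r)" for S K
  proof -
    \<comment> \<open>Each block of three indices contributes two letters:
      \<open>3 * i + 1, 3 * i + 2\<close> if \<open>i \<in> S\<close>, and
      \<open>3 * i, 3 * i + 1\<close> otherwise. So \<open>s i\<close> sits at an even position
      (above \<open>q\<close>) exactly when \<open>i \<in> S\<close>.\<close>
    define c where "c l = 3 * (l div 2) + (if l div 2 \<in> S then 1 + l mod 2 else l mod 2)" for l :: nat
    have "c l < c (Suc l)" for l
    proof (cases "even l")
      case True
      then have "Suc l div 2 = l div 2" "Suc l mod 2 = 1" "l mod 2 = 0" by presburger+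
      then show ?thesis by (simp add: c_def)
    next
      case False
      then have "Suc l div 2 = l div 2 + 1" "Suc l mod 2 = 0" "l mod 2 = 1" by presburger+
      then show ?thesis by (simp add: c_def)
    qed
    then have c: "strict_mono c" by (simp add: strict_mono_Suc_iff)
    have "sorted_wrt (<) (map c [0..<2 * K])"
      using c by (auto simp: sorted_wrt_map strict_mono_def intro: sorted_wrt_mono_rel[OF _ sorted_wrt_upt])
    from n(2)[rule_format, OF this] obtain h where h: "norm h \<le> 1" "\<And>l. l < 2 * K \<Longrightarrow> ok h l (n (c l))"
      by (auto simp: bad_def)
    have "if i \<in> S then q < blinfun_apply h (x (s i)) else blinfun_apply h (x (s i)) < r" if i: "i < K" for i
      using h(2)[of "2 * i"] h(2)[of "Suc (2 * i)"] i by (auto simp: ok_def c_def s_def)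
    with h(1) show ?thesis by blast
  qed
  ultimately show ?thesis by (intro that[of s] allI)
qed

text \<open>\<open>h1\<close> follows the signs of \<open>a\<close> and \<open>h2\<close> the
  opposite signs. Their difference gains \<open>(q - r) * \<bar>a i\<bar>\<close> in each term
  wherever \<open>q\<close> and \<open>r\<close> lie on the line; its norm is at most 2.\<close>

lemma l1_lower_bound:
  fixes x :: "nat \<Rightarrow> 'a::real_normed_vector"
  assumes ind: "\<And>S K. \<exists>h :: 'a \<Rightarrow>\<^sub>L real. norm h \<le> 1 \<and> (\<forall>i<K. if i \<in> S then q < blinfun_apply h (x i) else blinfun_apply h (x i) < r)"
  shows "(q - r) / 2 * (\<Sum>i<K. \<bar>a i\<bar>) \<le> norm (\<Sum>i<K. a i *\<^sub>R x i)"
proof -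
  obtain h1 :: "'a \<Rightarrow>\<^sub>L real" where h1: "norm h1 \<le> 1" "\<And>i. i < K \<Longrightarrow> if 0 \<le> a i then q < blinfun_apply h1 (x i) else blinfun_apply h1 (x i) < r"
    using ind[of K "{i. 0 \<le> a i}"] by auto
  obtain h2 :: "'a \<Rightarrow>\<^sub>L real" where h2: "norm h2 \<le> 1" "\<And>i. i < K \<Longrightarrow> if a i < 0 then q < blinfun_apply h2 (x i) else blinfun_apply h2 (x i) < r"
    using ind[of K "{i. a i < 0}"] by auto
  define v where "v = (\<Sum>i<K. a i *\<^sub>R x i)"
  have "(q - r) * \<bar>a i\<bar> \<le> a i * (blinfun_apply h1 (x i) - blinfun_apply h2 (x i))" if "i < K" for i
  proof (cases "0 \<le> a i")
    case True
    then have "q - r \<le> blinfun_apply h1 (x i) - blinfun_apply h2 (x i)" using h1(2)[OF that] h2(2)[OF that] by auto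
    from mult_left_mono[OF this True] True show ?thesis by (simp add: mult.commute)
  next
    case False
    then have "q - r \<le> blinfun_apply h2 (x i) - blinfun_apply h1 (x i)" using h1(2)[OF that] h2(2)[OF that] by auto
    from mult_left_mono[OF this, of "- a i"] False show ?thesis by (simp add: algebra_simps)
  qed
  then have "(q - r) * (\<Sum>i<K. \<bar>a i\<bar>) \<le> (\<Sum>i<K. a i * (blinfun_apply h1 (x i) - blinfun_apply h2 (x i)))"
    unfolding sum_distrib_left by (intro sum_mono) simp
  also have "\<dots> = h1 v - h2 v"
    by (simp add: v_def blinfun.sum_right blinfun.scaleR_right sum_subtractf algebra_simps)
  also have "\<dots> \<le> norm v + norm v"
    using norm_blinfun[of h1 v] norm_blinfun[of h2 v] mult_right_mono[OF h1(1) norm_ge_zero[of v]]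
      mult_right_mono[OF h2(1) norm_ge_zero[of v]] by (simp add: abs_le_iff)
  finally show ?thesis by (simp add: v_def)
qed

lemma l1_embeds_intoI:
  fixes x :: "nat \<Rightarrow> 'a::banach"
  assumes bdd: "\<And>i. norm (x i) \<le> R" and c: "0 < c"
    and low: "\<And>a K. c * (\<Sum>i<K. \<bar>a i\<bar>) \<le> norm (\<Sum>i<K. a i *\<^sub>R x i)"
  shows "l1_embeds_into TYPE('a)"
  unfolding l1_embeds_into_def
proof (intro exI conjI ballI allI)
  define T where "T = (\<lambda>a. \<Sum>i. a i *\<^sub>R x i)"
  have sn: "summable (\<lambda>i. norm (a i *\<^sub>R x i))" if "a \<in> l1_space" for a
  proof (rule summable_comparison_test')
    show "summable (\<lambda>i. R * \<bar>a i\<bar>)" using that by (auto simp: l1_space_def intro: summable_mult)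
    show "norm (norm (a i *\<^sub>R x i)) \<le> R * \<bar>a i\<bar>" for i
      using mult_left_mono[OF bdd[of i] abs_ge_zero[of "a i"]] by (simp add: mult.commute)
  qed
  note s = summable_norm_cancel[OF sn]
  show "0 < c" by (rule c)
  show "T (\<lambda>n. a n + b n) = T a + T b" if "a \<in> l1_space" "b \<in> l1_space" for a b
    using suminf_add[OF s[OF that(1)] s[OF that(2)]] by (simp add: T_def scaleR_add_left)
  show "T (\<lambda>n. r * a n) = r *\<^sub>R T a" if "a \<in> l1_space" for a r
    using suminf_scaleR_right[OF s[OF that], of r] by (simp add: T_def)
  show "c * l1_norm a \<le> norm (T a)" if a: "a \<in> l1_space" for a
  proof (rule tendsto_le)
    show "(\<lambda>K. norm (\<Sum>i<K. a i *\<^sub>R x i)) \<longlonglongrightarrow> norm (T a)"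
      unfolding T_def by (intro tendsto_norm summable_LIMSEQ s a)
    show "(\<lambda>K. c * (\<Sum>i<K. \<bar>a i\<bar>)) \<longlonglongrightarrow> c * l1_norm a"
      using a unfolding l1_norm_def l1_space_def by (intro tendsto_intros summable_LIMSEQ) simp
  qed (use low in auto)
  show "norm (T a) \<le> R * l1_norm a" if a: "a \<in> l1_space" for a
  proof -
    have sa: "summable (\<lambda>i. \<bar>a i\<bar>)" using a by (simp add: l1_space_def)
    have "norm (T a) \<le> (\<Sum>i. norm (a i *\<^sub>R x i))" unfolding T_def by (rule summable_norm[OF sn[OF a]])
    also have "\<dots> \<le> (\<Sum>i. R * \<bar>a i\<bar>)"
    proof (rule suminf_le[OF _ sn[OF a] summable_mult[OF sa]])
      show "norm (a i *\<^sub>R x i) \<le> R * \<bar>a i\<bar>" for i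
        using mult_left_mono[OF bdd[of i] abs_ge_zero[of "a i"]] by (simp add: mult.commute)
    qed
    also have "\<dots> = R * l1_norm a" unfolding l1_norm_def by (rule suminf_mult[OF sa])
    finally show ?thesis .
  qed
qed

lemma rosenthal_l1:
  fixes x :: "nat \<Rightarrow> 'a::banach"
  assumes U: "ultra U" "U \<le> sequentially"
    and bdd: "\<And>n. norm (x n) \<le> R" and no_l1: "\<not> l1_embeds_into TYPE('a)"
  obtains (subsequence) n :: "nat \<Rightarrow> nat" where "strict_mono n" "weakly_Cauchy (x \<circ> n)"
proof (rule ccontr)
  assume neg: "\<not> thesis"
  have nwc: "\<not> weakly_Cauchy (x \<circ> n)" if "strict_mono n" for n
    using neg that subsequence by blast
  obtain r q :: real and s :: "nat \<Rightarrow> nat" where rq: "r < q" and s: "strict_mono s"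
    "\<forall>n. strict_mono n \<longrightarrow> oscillates x r q (s \<circ> n)"
    by (rule hereditary_oscillation[OF bdd], rule nwc, assumption) (rule that)
  have osc: "oscillates (x \<circ> s) r q n" if "strict_mono n" for n
    using s(2)[rule_format, OF that] by (simp add: oscillates_def)
  obtain s' :: "nat \<Rightarrow> nat" where s': "\<forall>S K. \<exists>h :: 'a \<Rightarrow>\<^sub>L real. norm h \<le> 1 \<and>
      (\<forall>i<K. if i \<in> S then q < blinfun_apply h ((x \<circ> s) (s' i)) else blinfun_apply h ((x \<circ> s) (s' i)) < r)"
    by (rule independent_subsequence[OF U, of "x \<circ> s" r q], rule osc, assumption) (rule that)
  have "l1_embeds_into TYPE('a)"
  proof (rule l1_embeds_intoI)
    show "norm ((x \<circ> s) (s' i)) \<le> R" for i by (simp add: bdd)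
    show "0 < (q - r) / 2" using rq by simp
    show "(q - r) / 2 * (\<Sum>i<K. \<bar>a i\<bar>) \<le> norm (\<Sum>i<K. a i *\<^sub>R (x \<circ> s) (s' i))" for a K
      by (rule l1_lower_bound[OF s'[rule_format]])
  qed
  with no_l1 show False by blast
qed

subsection \<open>Weak-star sequential limits in the bidual\<close>

text \<open>The approximating sequence may lie outside \<open>S\<close>, so the property passes to
  subsets at once.\<close>

definition separable_in :: "'a::real_normed_vector set \<Rightarrow> bool" where
  "separable_in S \<longleftrightarrow> (\<exists>d :: nat \<Rightarrow> 'a. \<forall>x\<in>S. \<forall>e>0. \<exists>n. norm (x - d n) < e)"

text \<open>By symmetry of the ball, \<open>K\<close> also bounds the absolute value, so
  \<open>norm z * norm \<psi> \<le> K\<close>. It takes the place of separating convex sets in the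
  Goldstine argument.\<close>

lemma bidual_apply_le:
  fixes z :: "('a::real_normed_vector \<Rightarrow>\<^sub>L real) \<Rightarrow>\<^sub>L real" and \<psi> :: "'a \<Rightarrow>\<^sub>L real"
  assumes K: "\<And>y. norm y \<le> norm z \<Longrightarrow> blinfun_apply \<psi> y \<le> K"
  shows "blinfun_apply z \<psi> \<le> K"
proof (cases "z = 0")
  case True
  then show ?thesis using K[of 0] by (simp add: blinfun.zero_right)
next
  case False
  then have R: "0 < norm z" by simp
  have K0: "0 \<le> K" using K[of 0] by (simp add: blinfun.zero_right)
  have "norm (\<psi> v) \<le> K / norm z * norm v" for v
  proof (cases "v = 0")
    case False
    define c where "c = norm z / norm v"
    have c: "0 < c" "c * norm v = norm z" using R False by (auto simp: c_def)
    have "c * \<psi> v \<le> K" "c * - \<psi> v \<le> K"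
      using K[of "c *\<^sub>R v"] K[of "(- c) *\<^sub>R v"] c
      by (simp_all add: blinfun.scaleR_right blinfun.minus_right)
    then have "c * \<bar>\<psi> v\<bar> \<le> K" by (simp add: abs_if)
    then show ?thesis using R False by (simp add: c_def field_simps)
  qed (simp add: blinfun.zero_right)
  then have "norm \<psi> \<le> K / norm z"
    using K0 R by (intro norm_blinfun_bound) auto
  then have "norm z * norm \<psi> \<le> K" using R by (simp add: field_simps)
  then show ?thesis using norm_blinfun[of z \<psi>] by (simp add: abs_le_iff)
qed

text \<open>An almost-minimiser over the ball of the squared distance to the prescribed values satisfies an
  approximate variational inequality, which bounds the minimum by 0.\<close>
lemma goldstine_finite:
  fixes z :: "('a::real_normed_vector \<Rightarrow>\<^sub>L real) \<Rightarrow>\<^sub>L real" and \<phi> :: "nat \<Rightarrow> 'a \<Rightarrow>\<^sub>L real"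
  assumes e: "0 < e"
  obtains (approx) x where "norm x \<le> norm z" "\<And>i. i < m \<Longrightarrow> \<bar>blinfun_apply (\<phi> i) x - blinfun_apply z (\<phi> i)\<bar> < e"
proof (rule ccontr)
  assume neg: "\<not> thesis"
  define R where "R = norm z"
  define Q where "Q x = (\<Sum>i<m. (z (\<phi> i) - \<phi> i x)\<^sup>2)" for x
  define C where "C = (\<Sum>i<m. (norm (\<phi> i) * (R + R))\<^sup>2)"
  have C0: "0 \<le> C" by (simp add: C_def sum_nonneg)
  have Qe: "e\<^sup>2 \<le> Q x" if x: "norm x \<le> R" for x
  proof -
    have "\<not> (\<forall>i<m. \<bar>\<phi> i x - z (\<phi> i)\<bar> < e)"
      using neg approx[of x] x unfolding R_def by blast
    then obtain i where i: "i < m" "e \<le> \<bar>\<phi> i x - z (\<phi> i)\<bar>"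
      by (auto simp: not_less)
    then have "e\<^sup>2 \<le> (z (\<phi> i) - \<phi> i x)\<^sup>2"
      using e by (metis abs_le_square_iff abs_minus_commute abs_of_pos)
    also have "\<dots> \<le> Q x" unfolding Q_def using i(1)
      by (intro member_le_sum) auto
    finally show ?thesis .
  qed
  define D where "D = (INF x\<in>cball 0 R. Q x)"
  have bdd: "bdd_below (Q ` cball 0 R)" by (rule bdd_belowI2[where m = 0]) (simp add: Q_def sum_nonneg)
  have ne: "cball (0::'a) R \<noteq> {}" by (simp add: R_def)
  have DQ: "D \<le> Q x" if "norm x \<le> R" for x
    unfolding D_def using that by (intro cINF_lower[OF bdd]) simp
  have main: "e\<^sup>2 \<le> \<eta> * (1 + C) / 2" if \<eta>: "0 < \<eta>" "\<eta> \<le> 1" for \<eta>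
  proof -
    \<comment> \<open>The slack is quadratic so that after a move by the fraction
      \<open>\<eta>\<close> and division by \<open>\<eta>\<close> only a term of order
      \<open>\<eta>\<close> remains.\<close>
    have "D < D + \<eta>\<^sup>2" using \<eta> by simp
    then obtain x where x: "norm x \<le> R" "Q x < D + \<eta>\<^sup>2"
      unfolding D_def using cINF_less_iff[OF ne bdd] by (metis mem_cball_0)
    \<comment> \<open>Minus half the derivative of \<open>Q\<close> at \<open>x\<close>. Moving from
      \<open>x\<close> towards a point \<open>y\<close> of the ball stays in the ball and cannot
      push \<open>Q\<close> below \<open>D\<close>.\<close>
    define \<psi> where "\<psi> = (\<Sum>i<m. (z (\<phi> i) - \<phi> i x) *\<^sub>R \<phi> i)"
    have \<psi>: "\<psi> v = (\<Sum>i<m. (z (\<phi> i) - \<phi> i x) * \<phi> i v)" for v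
      by (simp add: \<psi>_def blinfun.sum_left blinfun.scaleR_left)
    have "\<psi> y \<le> \<psi> x + \<eta> * (1 + C) / 2" if y: "norm y \<le> norm z" for y
    proof -
      have "norm (x + \<eta> *\<^sub>R (y - x)) \<le> R"
      proof -
        have "x + \<eta> *\<^sub>R (y - x) = (1 - \<eta>) *\<^sub>R x + \<eta> *\<^sub>R y" by (simp add: algebra_simps)
        also have "norm \<dots> \<le> (1 - \<eta>) * norm x + \<eta> * norm y"
          using norm_triangle_ineq[of "(1 - \<eta>) *\<^sub>R x" "\<eta> *\<^sub>R y"] \<eta> by simp
        also have "\<dots> \<le> (1 - \<eta>) * R + \<eta> * R"
          using x(1) y \<eta> by (intro add_mono mult_left_mono) (auto simp: R_def)
        finally show ?thesis by (simp add: algebra_simps)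
      qed
      then have "D \<le> Q (x + \<eta> *\<^sub>R (y - x))" by (rule DQ)
      also have "Q (x + \<eta> *\<^sub>R (y - x)) = (\<Sum>i<m. (z (\<phi> i) - \<phi> i x)\<^sup>2
          - 2 * \<eta> * ((z (\<phi> i) - \<phi> i x) * \<phi> i (y - x)) + \<eta>\<^sup>2 * (\<phi> i (y - x))\<^sup>2)"
        unfolding Q_def blinfun.add_right blinfun.scaleR_right real_scaleR_def
        by (intro sum.cong refl) (simp add: power2_eq_square algebra_simps)
      also have "\<dots> = Q x - 2 * \<eta> * \<psi> (y - x) + \<eta>\<^sup>2 * (\<Sum>i<m. (\<phi> i (y - x))\<^sup>2)"
        by (simp add: Q_def \<psi> sum.distrib sum_subtractf sum_distrib_left)
      also have "(\<Sum>i<m. (\<phi> i (y - x))\<^sup>2) \<le> C"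
        unfolding C_def
      proof (rule sum_mono)
        fix i
        have "norm (y - x) \<le> R + R" using norm_triangle_ineq4[of y x] x(1) y by (simp add: R_def)
        then have "\<bar>\<phi> i (y - x)\<bar> \<le> norm (\<phi> i) * (R + R)"
          using norm_blinfun[of "\<phi> i" "y - x"] mult_left_mono[OF _ norm_ge_zero[of "\<phi> i"], of "norm (y - x)" "R + R"]
          by simp
        then show "(\<phi> i (y - x))\<^sup>2 \<le> (norm (\<phi> i) * (R + R))\<^sup>2" by (rule power2_le_iff_abs_le[THEN iffD2, rotated]) (simp add: R_def)
      qed
      finally have "D \<le> Q x - 2 * \<eta> * \<psi> (y - x) + \<eta>\<^sup>2 * C" by (simp add: mult_left_mono)
      then have "\<eta> * (2 * \<psi> (y - x)) \<le> \<eta> * (\<eta> * (1 + C))"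
        using x(2) by (simp add: power2_eq_square algebra_simps)
      then have "2 * \<psi> (y - x) \<le> \<eta> * (1 + C)" using \<eta>(1) by simp
      then show ?thesis by (simp add: blinfun.diff_right)
    qed
    then have "z \<psi> \<le> \<psi> x + \<eta> * (1 + C) / 2" by (rule bidual_apply_le)
    moreover have "z \<psi> = (\<Sum>i<m. (z (\<phi> i) - \<phi> i x) * z (\<phi> i))"
      by (simp only: \<psi>_def blinfun.sum_right blinfun.scaleR_right real_scaleR_def)
    \<comment> \<open>The residuals are paired with themselves, so the variational inequality bounds
      the squared distance itself.\<close>
    then have "z \<psi> - \<psi> x = Q x"
      by (simp add: \<psi> Q_def sum_subtractf[symmetric] power2_eq_square algebra_simps)
    ultimately show ?thesis using Qe[OF x(1)] by linarith
  qed
  define \<eta> where "\<eta> = min 1 (e\<^sup>2 / (1 + C))"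
  have "0 < \<eta>" "\<eta> \<le> 1" using e C0 by (auto simp: \<eta>_def intro!: divide_pos_pos)
  then have "e\<^sup>2 \<le> \<eta> * (1 + C) / 2" by (rule main)
  also have "\<eta> * (1 + C) \<le> e\<^sup>2 / (1 + C) * (1 + C)"
    using C0 by (intro mult_right_mono) (auto simp: \<eta>_def)
  also have "\<dots> = e\<^sup>2" using C0 by simp
  finally show False using e by simp
qed

lemma goldstine_sequence:
  fixes z :: "('a::real_normed_vector \<Rightarrow>\<^sub>L real) \<Rightarrow>\<^sub>L real" and \<phi> :: "nat \<Rightarrow> 'a \<Rightarrow>\<^sub>L real"
  obtains x :: "nat \<Rightarrow> 'a" where "\<forall>n. norm (x n) \<le> norm z" "\<forall>i. (\<lambda>n. blinfun_apply (\<phi> i) (x n)) \<longlonglongrightarrow> blinfun_apply z (\<phi> i)"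
proof -
  have "\<exists>x. norm x \<le> norm z \<and> (\<forall>i<n. \<bar>\<phi> i x - z (\<phi> i)\<bar> < 1 / real (Suc n))" for n
    using goldstine_finite[of "1 / real (Suc n)" z n \<phi>] by (metis of_nat_0_less_iff zero_less_Suc zero_less_divide_1_iff)
  then obtain x :: "nat \<Rightarrow> 'a" where x: "\<forall>n. norm (x n) \<le> norm z"
      "\<And>n i. i < n \<Longrightarrow> \<bar>\<phi> i (x n) - z (\<phi> i)\<bar> < 1 / real (Suc n)"
    by metis
  have "(\<lambda>n. \<phi> i (x n) - z (\<phi> i)) \<longlonglongrightarrow> 0" for i
  proof (rule Lim_null_comparison)
    show "\<forall>\<^sub>F n in sequentially. norm (\<phi> i (x n) - z (\<phi> i)) \<le> 1 / real (Suc n)"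
      using eventually_gt_at_top[of i] by eventually_elim (use x(2) in \<open>auto intro: less_imp_le\<close>)
    show "(\<lambda>n. 1 / real (Suc n)) \<longlonglongrightarrow> 0" using LIMSEQ_inverse_real_of_nat by (simp add: inverse_eq_divide)
  qed
  then have "(\<lambda>n. \<phi> i (x n)) \<longlonglongrightarrow> z (\<phi> i)" for i by (simp add: LIM_zero_iff)
  then show ?thesis using x(1) by (intro that[of x]) auto
qed

lemma tendsto_on_closure_span:
  fixes z :: "('a::real_normed_vector \<Rightarrow>\<^sub>L real) \<Rightarrow>\<^sub>L real"
  assumes bdd: "\<And>n. norm (x n) \<le> R"
    and S: "\<And>h. h \<in> S \<Longrightarrow> (\<lambda>n. blinfun_apply h (x n)) \<longlonglongrightarrow> blinfun_apply z h"
    and h: "h \<in> closure (span S)"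
  shows "(\<lambda>n. blinfun_apply h (x n)) \<longlonglongrightarrow> blinfun_apply z h"
proof (rule LIMSEQ_I)
  fix r :: real assume r: "0 < r"
  have sp: "(\<lambda>n. blinfun_apply g (x n)) \<longlonglongrightarrow> blinfun_apply z g" if "g \<in> span S" for g
    using that
  proof (induction rule: span_induct_alt)
    case base
    show ?case by (simp add: blinfun.zero_left blinfun.zero_right)
  next
    case (step c g g')
    then show ?case using S[of g]
      by (auto simp: blinfun.add_left blinfun.add_right blinfun.scaleR_left blinfun.scaleR_right
          intro!: tendsto_intros)
  qed
  define W where "W = R + norm z + 1"
  have "0 \<le> R" using bdd[of 0] norm_ge_zero order_trans by blast
  then have W: "0 < W" by (simp add: W_def add_nonneg_pos)
  obtain g where g: "g \<in> span S" "dist g h < r / (2 * W)"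
    using h r W unfolding closure_approachable by (metis divide_pos_pos mult_pos_pos zero_less_numeral)
  obtain N where N: "\<And>n. n \<ge> N \<Longrightarrow> \<bar>g (x n) - z g\<bar> < r / 2"
    using LIMSEQ_D[OF sp[OF g(1)], of "r / 2"] r by auto
  have "norm (h (x n) - z h) < r" if "n \<ge> N" for n
  proof -
    have "\<bar>(h - g) (x n)\<bar> \<le> norm (h - g) * R"
      using norm_blinfun[of "h - g" "x n"] mult_left_mono[OF bdd norm_ge_zero] by (metis order_trans real_norm_def)
    moreover have "\<bar>z (h - g)\<bar> \<le> norm (h - g) * norm z"
      using norm_blinfun[of z "h - g"] by (simp add: mult.commute)
    moreover have "norm (h - g) * R + norm (h - g) * norm z \<le> norm (h - g) * W"
      by (simp add: W_def algebra_simps)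
    moreover have "norm (h - g) * W \<le> r / 2"
      using g(2) W by (simp add: dist_norm norm_minus_commute field_simps)
    moreover have "h (x n) - z h = (h - g) (x n) - z (h - g) + (g (x n) - z g)"
      by (simp add: blinfun.diff_left blinfun.diff_right)
    ultimately show ?thesis using N[OF that] unfolding real_norm_def by linarith
  qed
  then show "\<exists>no. \<forall>n\<ge>no. norm (h (x n) - z h) < r" by blast
qed

lemma weakly_Cauchy_limit:
  fixes x :: "nat \<Rightarrow> 'a::real_normed_vector"
  assumes wc: "weakly_Cauchy x" and bdd: "\<And>n. norm (x n) \<le> R"
  obtains z :: "('a \<Rightarrow>\<^sub>L real) \<Rightarrow>\<^sub>L real" where "\<forall>h. (\<lambda>n. blinfun_apply h (x n)) \<longlonglongrightarrow> blinfun_apply z h"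
proof -
  define \<zeta> where "\<zeta> h = lim (\<lambda>n. blinfun_apply h (x n))" for h :: "'a \<Rightarrow>\<^sub>L real"
  have \<zeta>: "(\<lambda>n. blinfun_apply h (x n)) \<longlonglongrightarrow> \<zeta> h" for h
    using wc by (simp add: weakly_Cauchy_def \<zeta>_def convergent_LIMSEQ_iff)
  have "bounded_linear \<zeta>"
  proof (rule bounded_linear_intro[where K = R])
    show "\<zeta> (g + h) = \<zeta> g + \<zeta> h" for g h
      using tendsto_add[OF \<zeta>[of g] \<zeta>[of h]] \<zeta>[of "g + h"]
      by (simp add: blinfun.add_left LIMSEQ_unique)
    show "\<zeta> (r *\<^sub>R h) = r *\<^sub>R \<zeta> h" for r h
      using tendsto_mult_left[OF \<zeta>[of h], of r] \<zeta>[of "r *\<^sub>R h"]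
      by (simp add: blinfun.scaleR_left LIMSEQ_unique)
    show "norm (\<zeta> h) \<le> norm h * R" for h
    proof (rule tendsto_upperbound[OF tendsto_norm[OF \<zeta>]])
      show "\<forall>\<^sub>F n in sequentially. norm (blinfun_apply h (x n)) \<le> norm h * R"
        using norm_blinfun[of h] mult_left_mono[OF bdd norm_ge_zero[of h]]
        by (intro always_eventually allI) (rule order_trans)
    qed simp
  qed
  with \<zeta> show ?thesis by (intro that[of "Blinfun \<zeta>"]) (simp add: bounded_linear_Blinfun_apply)
qed

lemma sublinear_infdist:
  fixes M :: "'v::real_normed_vector set"
  assumes M: "subspace M"
  shows "sublinear (\<lambda>x. infdist x M)"
proof -
  have ne: "M \<noteq> {}" using subspace_0[OF M] by blast
  have approx: "\<exists>v\<in>M. norm (x - v) < infdist x M + e" if "0 < e" for x e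
  proof -
    have "(INF v\<in>M. dist x v) < infdist x M + e" using that by (simp add: infdist_notempty[OF ne])
    then show ?thesis using cINF_less_iff[OF ne bdd_belowI2[of M 0 "dist x"]]
      by (simp add: dist_norm)
  qed
  have le: "infdist x M \<le> norm (x - v)" if "v \<in> M" for x v
    using infdist_le[OF that, of x] by (simp add: dist_norm)
  have "infdist (x + y) M \<le> infdist x M + infdist y M" for x y
  proof (rule field_le_epsilon)
    fix e :: real assume "0 < e"
    then obtain v w where v: "v \<in> M" "norm (x - v) < infdist x M + e / 2"
      and w: "w \<in> M" "norm (y - w) < infdist y M + e / 2"
      using approx[of "e / 2"] by (metis half_gt_zero)
    have "infdist (x + y) M \<le> norm ((x + y) - (v + w))" using M v w by (intro le subspace_add)
    also have "\<dots> \<le> norm (x - v) + norm (y - w)"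
      using norm_triangle_ineq[of "x - v" "y - w"] by (simp add: algebra_simps)
    finally show "infdist (x + y) M \<le> infdist x M + infdist y M + e" using v w by simp
  qed
  moreover have hom: "infdist (r *\<^sub>R x) M \<le> r * infdist x M" if r: "0 < r" for r x
  proof (rule field_le_epsilon)
    fix e :: real assume "0 < e"
    then obtain v where v: "v \<in> M" "norm (x - v) < infdist x M + e / r"
      using approx[of "e / r"] r by (metis divide_pos_pos)
    have "infdist (r *\<^sub>R x) M \<le> norm (r *\<^sub>R x - r *\<^sub>R v)" using M v by (intro le subspace_scale)
    also have "\<dots> = r * norm (x - v)" using r by (simp add: scaleR_diff_right[symmetric])
    also have "\<dots> \<le> r * (infdist x M + e / r)" using v r by (intro mult_left_mono) auto
    also have "\<dots> = r * infdist x M + e" using r by (simp add: field_simps)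
    finally show "infdist (r *\<^sub>R x) M \<le> r * infdist x M + e" .
  qed
  moreover have "infdist (r *\<^sub>R x) M = r * infdist x M" if "0 \<le> r" for r x
  proof (cases "r = 0")
    case True
    then show ?thesis using subspace_0[OF M] by simp
  next
    case False
    with that have r: "0 < r" by simp
    have "infdist ((1 / r) *\<^sub>R (r *\<^sub>R x)) M \<le> (1 / r) * infdist (r *\<^sub>R x) M"
      using r by (intro hom) simp
    then have "r * infdist x M \<le> infdist (r *\<^sub>R x) M" using r by (simp add: field_simps)
    with hom[OF r, of x] show ?thesis by simp
  qed
  ultimately show ?thesis unfolding sublinear_def by blast
qed

text \<open>Hahn-Banach with the quotient seminorm as majorant: it vanishes on \<open>M\<close>,
  which forces the functional to vanish there, and at \<open>w\<close> it is the positive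
  distance.\<close>

lemma annihilating_functional:
  fixes M :: "'v::real_normed_vector set"
  assumes M: "subspace M" and w: "w \<notin> closure M"
  obtains z :: "'v \<Rightarrow>\<^sub>L real" where "\<forall>v\<in>M. blinfun_apply z v = 0" "0 < blinfun_apply z w"
proof -
  obtain h where h: "linear h" "\<And>x. h x \<le> infdist x M" "h w = infdist w M"
    using hahn_banach[OF sublinear_infdist[OF M]] by blast
  have "h x \<le> norm x" for x
    using h(2)[of x] infdist_le[OF subspace_0[OF M], of x] by simp
  then have bl: "bounded_linear h" by (rule bounded_linear_of_le_norm[OF h(1)])
  have "h v = 0" if "v \<in> M" for v
    using h(2)[of v] h(2)[of "- v"] that subspace_neg[OF M that] linear_neg[OF h(1), of v] by simp
  moreover have "M \<noteq> {}" using subspace_0[OF M] by blast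
  then have "0 < h w"
    using w in_closure_iff_infdist_zero[of M w] infdist_nonneg[of w M] h(3) by simp
  ultimately show ?thesis
    using bl by (intro that[of "Blinfun h"]) (simp_all add: bounded_linear_Blinfun_apply)
qed

definition seq_limits :: "(('a::real_normed_vector \<Rightarrow>\<^sub>L real) \<Rightarrow>\<^sub>L real) set" where
  "seq_limits = {z. \<exists>x R. (\<forall>n. norm (x n) \<le> R) \<and>
     (\<forall>h. (\<lambda>n. blinfun_apply h (x n)) \<longlonglongrightarrow> blinfun_apply z h)}"

lemma countable_weakly_dense_in_ball:
  fixes d :: "nat \<Rightarrow> 'v::real_normed_vector \<Rightarrow>\<^sub>L real"
  obtains s :: "nat \<Rightarrow> 'v" where "\<forall>w i e. norm w \<le> 1 \<and> 0 < e \<longrightarrow>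
    (\<exists>n. norm (s n) \<le> 1 \<and> \<bar>blinfun_apply (d i) (s n) - blinfun_apply (d i) w\<bar> < e)"
proof -
  define ok where "ok = (\<lambda>(i, q, N) w. norm w \<le> 1 \<and> \<bar>blinfun_apply (d i) w - of_rat q\<bar> < 1 / real (Suc N))"
  \<comment> \<open>If no \<open>w\<close> fits the test, the chosen vector is arbitrary; hence the
    bound \<open>norm (s n) \<le> 1\<close> sits under the existential quantifier of the
    claim.\<close>
  define s where "s n = (SOME w. ok (from_nat n) w)" for n
  have "\<exists>n. norm (s n) \<le> 1 \<and> \<bar>d i (s n) - d i w\<bar> < e" if w: "norm w \<le> 1" and e: "0 < e" for w i e
  proof -
    obtain N where N: "1 / real (Suc N) < e / 2" using nat_approx_posE[of "e / 2"] e by auto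
    obtain q where q: "d i w < of_rat q" "of_rat q < d i w + 1 / real (Suc N)"
      using of_rat_dense[of "d i w" "d i w + 1 / real (Suc N)"] by auto
    define n where "n = to_nat (i, q, N)"
    have "ok (from_nat n) w" using w q by (simp add: ok_def n_def)
    then have "ok (from_nat n) (s n)" unfolding s_def by (rule someI)
    then have "norm (s n) \<le> 1" "\<bar>d i (s n) - of_rat q\<bar> < 1 / real (Suc N)"
      by (simp_all add: ok_def n_def)
    moreover from this(2) have "\<bar>d i (s n) - d i w\<bar> < e" using q N by linarith
    ultimately show ?thesis by blast
  qed
  then show ?thesis by (intro that[of s]) blast
qed

text \<open>If \<open>seq_limits\<close> were separable, countably many functionals of norm at most 1 would be dense in
  the unit ball of the dual for the topology induced by \<open>seq_limits\<close>. By Rosenthal's theorem their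
  closed span is the whole dual, so every bidual element is a weak-star limit of a sequence.\<close>
lemma seq_limits_not_separable:
  assumes U: "ultra U" "U \<le> sequentially"
    and no_l1: "\<not> l1_embeds_into TYPE('a::banach)"
    and nonsep: "\<not> separable_in (UNIV :: (('a \<Rightarrow>\<^sub>L real) \<Rightarrow>\<^sub>L real) set)"
  shows "\<not> separable_in (seq_limits :: (('a \<Rightarrow>\<^sub>L real) \<Rightarrow>\<^sub>L real) set)"
proof
  assume sep: "separable_in (seq_limits :: (('a \<Rightarrow>\<^sub>L real) \<Rightarrow>\<^sub>L real) set)"
  then obtain d :: "nat \<Rightarrow> ('a \<Rightarrow>\<^sub>L real) \<Rightarrow>\<^sub>L real"
    where d: "\<And>z e. z \<in> seq_limits \<Longrightarrow> 0 < e \<Longrightarrow> \<exists>n. norm (z - d n) < e"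
    unfolding separable_in_def by blast
  obtain s :: "nat \<Rightarrow> 'a \<Rightarrow>\<^sub>L real" where s: "\<forall>w i e. norm w \<le> 1 \<and> 0 < e \<longrightarrow>
      (\<exists>n. norm (s n) \<le> 1 \<and> \<bar>d i (s n) - d i w\<bar> < e)"
    by (rule countable_weakly_dense_in_ball[of d]) (rule that)
  show False
  proof (cases "closure (span (range s)) = UNIV")
    case True
    have "z \<in> seq_limits" for z :: "('a \<Rightarrow>\<^sub>L real) \<Rightarrow>\<^sub>L real"
    proof -
      obtain x :: "nat \<Rightarrow> 'a" where x: "\<forall>n. norm (x n) \<le> norm z" "\<forall>i. (\<lambda>n. blinfun_apply (s i) (x n)) \<longlonglongrightarrow> z (s i)"
        by (rule goldstine_sequence[of z s]) (rule that)
      have "(\<lambda>n. blinfun_apply h (x n)) \<longlonglongrightarrow> z h" for h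
        by (rule tendsto_on_closure_span[OF x(1)[rule_format], of "range s"]) (use x(2) True in auto)
      with x(1) show ?thesis unfolding seq_limits_def by blast
    qed
    then have "seq_limits = (UNIV :: (('a \<Rightarrow>\<^sub>L real) \<Rightarrow>\<^sub>L real) set)" by blast
    then show False using sep nonsep by simp
  next
    case False
    then obtain w0 where w0: "w0 \<notin> closure (span (range s))" by blast
    then obtain z :: "('a \<Rightarrow>\<^sub>L real) \<Rightarrow>\<^sub>L real" where z: "\<forall>v\<in>span (range s). blinfun_apply z v = 0" "0 < blinfun_apply z w0"
      using annihilating_functional[OF subspace_span w0] by metis
    define w where "w = (1 / norm w0) *\<^sub>R w0"
    have "w0 \<noteq> 0" using z(2) by (auto simp: blinfun.zero_right)
    then have w: "norm w \<le> 1" "0 < z w" using z(2) by (auto simp: w_def blinfun.scaleR_right)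
    \<comment> \<open>\<open>z\<close> itself need not be a sequential limit. Prescribing the values
      at \<open>w\<close> and at every \<open>s i\<close> together makes the limit \<open>z'\<close>
      of a weakly Cauchy subsequence agree with \<open>z\<close> there, and this is all that the
      contradiction uses.\<close>
    obtain x :: "nat \<Rightarrow> 'a" where x: "\<forall>n. norm (x n) \<le> norm z"
      "\<forall>i. (\<lambda>n. blinfun_apply (case_nat w s i) (x n)) \<longlonglongrightarrow> z (case_nat w s i)"
      by (rule goldstine_sequence[of z "case_nat w s"]) (rule that)
    obtain n :: "nat \<Rightarrow> nat" where n: "strict_mono n" "weakly_Cauchy (x \<circ> n)"
      by (rule rosenthal_l1[OF U x(1)[rule_format] no_l1]) (rule that)
    have "norm ((x \<circ> n) i) \<le> norm z" for i using x(1) by simp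
    then obtain z' :: "('a \<Rightarrow>\<^sub>L real) \<Rightarrow>\<^sub>L real"
      where z': "\<forall>h. (\<lambda>i. blinfun_apply h ((x \<circ> n) i)) \<longlonglongrightarrow> blinfun_apply z' h"
      using weakly_Cauchy_limit[OF n(2), of "norm z"] by blast
    have "z' \<in> seq_limits" unfolding seq_limits_def using z' x(1)
      by (intro CollectI exI[of _ "x \<circ> n"] exI[of _ "norm z"]) simp
    have eq: "z' (case_nat w s i) = z (case_nat w s i)" for i
    proof -
      have "(\<lambda>j. blinfun_apply (case_nat w s i) ((x \<circ> n) j)) \<longlonglongrightarrow> z (case_nat w s i)"
        using LIMSEQ_subseq_LIMSEQ[OF x(2)[rule_format, of i] n(1)] by (simp add: comp_def)
      with z' show ?thesis by (blast intro: LIMSEQ_unique)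
    qed
    have zw: "z' w = z w" using eq[of 0] by simp
    have zs: "z' (s i) = 0" for i using eq[of "Suc i"] z(1) by (simp add: span_base)
    have w4: "0 < z w / 4" using w by simp
    obtain i where i: "norm (z' - d i) < z w / 4" using d[OF \<open>z' \<in> seq_limits\<close> w4] by blast
    obtain m where m: "norm (s m) \<le> 1" "\<bar>d i (s m) - d i w\<bar> < z w / 4" using s w(1) w4 by blast
    have close: "\<bar>(z' - d i) v\<bar> < z w / 4" if "norm v \<le> 1" for v
      using norm_blinfun[of "z' - d i" v] mult_left_mono[OF that norm_ge_zero[of "z' - d i"]] i by simp
    \<comment> \<open>Each of the three terms is smaller than \<open>z w / 4\<close>: two because
      \<open>d i\<close> is near \<open>z'\<close>, one because \<open>d i\<close> hardly tells
      \<open>s m\<close> from \<open>w\<close>.\<close>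
    have "z w = (z' - d i) w - (z' - d i) (s m) - (d i (s m) - d i w)"
      by (simp add: blinfun.diff_left zw zs)
    then show False using close[OF w(1)] close[OF m(1)] m(2) w(2) by linarith
  qed
qed

subsection \<open>Separability\<close>

lemma separable_in_if_separable_space:
  assumes "separable_space (subtopology euclidean S)"
  shows "separable_in S"
proof (cases "S = {}")
  case False
  obtain C where C: "countable C" "C \<subseteq> S" "S \<subseteq> closure C"
    using assms unfolding separable_space_def
    by (auto simp: closure_of_subtopology Int_absorb1)
  then have "C \<noteq> {}" using False by auto
  have "\<exists>n. norm (x - from_nat_into C n) < e" if x: "x \<in> S" and e: "0 < e" for x e
  proof -
    have "x \<in> closure C" using C(3) x by blast
    then obtain y where y: "y \<in> C" "dist y x < e" using e unfolding closure_approachable by blast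
    obtain n where "from_nat_into C n = y" using from_nat_into_surj[OF C(1) y(1)] by blast
    then show ?thesis using y(2) by (auto simp: dist_norm norm_minus_commute)
  qed
  then show ?thesis unfolding separable_in_def by blast
qed (simp add: separable_in_def)

lemma separable_space_if_separable_in:
  assumes "separable_in (UNIV :: 'v::real_normed_vector set)"
  shows "separable_space (euclidean :: 'v topology)"
proof -
  obtain d :: "nat \<Rightarrow> 'v" where d: "\<forall>x. \<forall>e>0. \<exists>n. norm (x - d n) < e"
    using assms unfolding separable_in_def by auto
  have "closure (range d) = UNIV"
    using d by (auto simp: closure_approachable dist_norm norm_minus_commute)
  then show ?thesis unfolding separable_space_def
    by (intro exI[of _ "range d"]) (simp add: countable_image)
qed

text \<open>Pigeonhole: two of uncountably many indices share the same nearby \<open>d n\<close>.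
  The indices are kept apart from the points because \<open>F\<close> need not be injective.\<close>

lemma separable_in_close_pair:
  assumes "separable_in S" "uncountable I" "F ` I \<subseteq> S" "0 < e"
  obtains i j where "i \<in> I" "j \<in> I" "i \<noteq> j" "norm (F i - F j) < e"
proof -
  obtain d :: "nat \<Rightarrow> _" where d: "\<forall>x\<in>S. \<forall>e>0. \<exists>n. norm (x - d n) < e"
    using assms(1) unfolding separable_in_def by blast
  then have "\<forall>i\<in>I. \<exists>n. norm (F i - d n) < e / 2"
    using assms(3,4) by (metis half_gt_zero image_subset_iff)
  then obtain n where n: "\<And>i. i \<in> I \<Longrightarrow> norm (F i - d (n i)) < e / 2" by metis
  have "\<not> inj_on n I" using assms(2) countableI by blast
  then obtain i j where ij: "i \<in> I" "j \<in> I" "i \<noteq> j" "n i = n j" by (auto simp: inj_on_def)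
  have "norm (F i - F j) \<le> norm (F i - d (n i)) + norm (F j - d (n j))"
    using norm_triangle_ineq4[of "F i - d (n i)" "F j - d (n j)"] ij(4) by simp
  then have "norm (F i - F j) < e" using n[OF ij(1)] n[OF ij(2)] by linarith
  with ij show ?thesis using that by blast
qed

text \<open>Take a maximal \<open>1 / Suc n\<close>-separated subset for each \<open>n\<close>. Were
  all of them countable, their union would be dense in \<open>S\<close> by maximality.\<close>

lemma not_separable_in_separated:
  fixes S :: "'v::real_normed_vector set"
  assumes "\<not> separable_in S"
  obtains \<theta> I where "0 < \<theta>" "I \<subseteq> S" "uncountable I"
    "\<And>x y. x \<in> I \<Longrightarrow> y \<in> I \<Longrightarrow> x \<noteq> y \<Longrightarrow> \<theta> \<le> norm (x - y)"
proof (rule ccontr)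
  assume neg: "\<not> thesis"
  define sepd where "sepd e I \<longleftrightarrow> I \<subseteq> S \<and> (\<forall>x\<in>I. \<forall>y\<in>I. x \<noteq> y \<longrightarrow> e \<le> norm (x - y))" for e :: real and I
  have "\<exists>I. sepd (1 / real (Suc n)) I \<and> (\<forall>J. sepd (1 / real (Suc n)) J \<longrightarrow> I \<subseteq> J \<longrightarrow> J = I)" for n
  proof -
    have "\<exists>M\<in>Collect (sepd (1 / real (Suc n))). \<forall>X\<in>Collect (sepd (1 / real (Suc n))). M \<subseteq> X \<longrightarrow> X = M"
    proof (rule subset_Zorn')
      fix C assume C: "subset.chain (Collect (sepd (1 / real (Suc n)))) C"
      then have mem: "\<And>I. I \<in> C \<Longrightarrow> sepd (1 / real (Suc n)) I"
        and ch: "\<And>I J. I \<in> C \<Longrightarrow> J \<in> C \<Longrightarrow> I \<subseteq> J \<or> J \<subseteq> I"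
        by (auto simp: subset_chain_def)
      have "1 / real (Suc n) \<le> norm (x - y)" if xy: "x \<in> \<Union>C" "y \<in> \<Union>C" "x \<noteq> y" for x y
      proof -
        obtain I J where IJ: "I \<in> C" "x \<in> I" "J \<in> C" "y \<in> J" using xy by blast
        then obtain K where "K \<in> C" "x \<in> K" "y \<in> K" using ch by blast
        then show ?thesis using mem[of K] xy(3) unfolding sepd_def by blast
      qed
      then show "\<Union>C \<in> Collect (sepd (1 / real (Suc n)))"
        using mem unfolding sepd_def by blast
    qed
    then show ?thesis by blast
  qed
  then obtain I where I: "\<And>n. sepd (1 / real (Suc n)) (I n)"
    "\<And>n J. sepd (1 / real (Suc n)) J \<Longrightarrow> I n \<subseteq> J \<Longrightarrow> J = I n" by metis
  have "countable (I n)" for n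
    using neg that[of "1 / real (Suc n)" "I n"] I(1)[of n] unfolding sepd_def by auto
  then have cnt: "countable (\<Union>n. I n)" by blast
  have close: "\<exists>y\<in>(\<Union>n. I n). norm (x - y) < e" if x: "x \<in> S" and e: "0 < e" for x e
  proof -
    obtain n where n: "1 / real (Suc n) < e" using nat_approx_posE[OF e] by blast
    show ?thesis
    proof (cases "x \<in> I n")
      case True
      then show ?thesis using e by (intro bexI[of _ x]) auto
    next
      case False
      then have "\<not> sepd (1 / real (Suc n)) (insert x (I n))" using I(2)[of n "insert x (I n)"] by blast
      then have "\<not> (\<forall>y\<in>I n. 1 / real (Suc n) \<le> norm (x - y))"
        using I(1)[of n] x unfolding sepd_def by (auto simp: norm_minus_commute)
      then obtain y where "y \<in> I n" "norm (x - y) < 1 / real (Suc n)"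
        by (auto simp: not_le)
      then show ?thesis using n by force
    qed
  qed
  have "\<forall>x\<in>S. \<forall>e>0. \<exists>n. norm (x - from_nat_into (\<Union>n. I n) n) < e"
  proof (intro ballI allI impI)
    fix x e assume "x \<in> S" "(0::real) < e"
    then obtain y where y: "y \<in> (\<Union>n. I n)" "norm (x - y) < e"
      using close by blast
    obtain n where "from_nat_into (\<Union>n. I n) n = y" using from_nat_into_surj[OF cnt y(1)] by blast
    then show "\<exists>n. norm (x - from_nat_into (\<Union>n. I n) n) < e" using y(2) by blast
  qed
  then show False using assms unfolding separable_in_def by blast
qed

subsection \<open>Iterated duals\<close>

lemma dual_copyD:
  assumes "dual_copy V W T"
  shows "subspace V" "subspace W"
    and "w \<in> W \<Longrightarrow> u \<in> V \<Longrightarrow> v \<in> V \<Longrightarrow> T w (u - v) = T w u - T w v"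
    and "w \<in> W \<Longrightarrow> v \<in> V \<Longrightarrow> \<bar>T w v\<bar> \<le> norm w * norm v"
proof -
  note D = assms[unfolded dual_copy_def bdd_lin_functional_on_def]
  show V: "subspace V" and W: "subspace W" using D by auto
  have add: "T w (u + v) = T w u + T w v" if "w \<in> W" "u \<in> V" "v \<in> V" for w u v using D that by blast
  have scale: "T w (r *\<^sub>R v) = r * T w v" if "w \<in> W" "v \<in> V" for w v r using D that by blast
  show "T w (u - v) = T w u - T w v" if "w \<in> W" "u \<in> V" "v \<in> V" for w u v
    using add[OF that(1) subspace_diff[OF V that(2,3)] that(3)] by simp
  show "\<bar>T w v\<bar> \<le> norm w * norm v" if w: "w \<in> W" and v: "v \<in> V" for w v
  proof (cases "v = 0")
    case True
    then show ?thesis using scale[OF w v, of 0] by simp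
  next
    case False
    have "\<exists>B. \<forall>v\<in>V. \<bar>T w v\<bar> \<le> B * norm v" using D w by blast
    then obtain B where B: "\<forall>v\<in>V. \<bar>T w v\<bar> \<le> B * norm v" ..
    \<comment> \<open>The supremum in \<open>dual_copy\<close> dominates its terms only when they
      are bounded above; boundedness of the functional supplies this.\<close>
    have "bdd_above ((\<lambda>v. \<bar>T w v\<bar>) ` {v \<in> V. norm v \<le> 1})"
    proof (rule bdd_aboveI2)
      fix u assume u: "u \<in> {v \<in> V. norm v \<le> 1}"
      then have "\<bar>T w u\<bar> \<le> B * norm u" using B by blast
      also have "\<dots> \<le> \<bar>B\<bar> * norm u" by (rule mult_right_mono) auto
      also have "\<dots> \<le> \<bar>B\<bar> * 1" using u by (intro mult_left_mono) auto
      finally show "\<bar>T w u\<bar> \<le> \<bar>B\<bar>" by simp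
    qed
    moreover have "(1 / norm v) *\<^sub>R v \<in> {v \<in> V. norm v \<le> 1}"
      using subspace_scale[OF V v] False by simp
    ultimately have "\<bar>T w ((1 / norm v) *\<^sub>R v)\<bar> \<le> (SUP v\<in>{v\<in>V. norm v \<le> 1}. \<bar>T w v\<bar>)"
      by (intro cSUP_upper)
    also have "\<dots> = norm w" using D w by simp
    finally show ?thesis using scale[OF w v] False by (simp add: abs_mult field_simps)
  qed
qed

lemma dual_copy_represents:
  assumes "dual_copy V W T"
    and add: "\<And>u v. u \<in> V \<Longrightarrow> v \<in> V \<Longrightarrow> f (u + v) = f u + f v"
    and scale: "\<And>r v. v \<in> V \<Longrightarrow> f (r *\<^sub>R v) = r * f v"
    and bound: "\<And>v. v \<in> V \<Longrightarrow> \<bar>f v\<bar> \<le> K * norm v" and K: "0 \<le> K"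
  obtains w where "w \<in> W" "\<forall>v\<in>V. T w v = f v" "norm w \<le> K"
proof -
  note D = assms(1)[unfolded dual_copy_def]
  have "bdd_lin_functional_on V f" unfolding bdd_lin_functional_on_def using add scale bound by blast
  then obtain w where w: "w \<in> W" "\<forall>v\<in>V. T w v = f v" using D by blast
  have "norm w = (SUP v\<in>{v\<in>V. norm v \<le> 1}. \<bar>T w v\<bar>)" using D w by blast
  also have "\<dots> \<le> K"
  proof (rule cSUP_least)
    have "0 \<in> {v \<in> V. norm v \<le> 1}" using subspace_0[of V] D by simp
    then show "{v \<in> V. norm v \<le> 1} \<noteq> {}" by blast
    show "\<bar>T w v\<bar> \<le> K" if "v \<in> {v \<in> V. norm v \<le> 1}" for v
    proof -
      have "\<bar>T w v\<bar> \<le> K * norm v" using that bound w(2) by simp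
      also have "\<dots> \<le> K * 1" using that K by (intro mult_left_mono) auto
      finally show ?thesis by simp
    qed
  qed
  finally show ?thesis using that w by blast
qed

locale dual_tower =
  fixes Vs :: "nat \<Rightarrow> 'u::real_normed_vector set" and Ts :: "nat \<Rightarrow> 'u \<Rightarrow> 'u \<Rightarrow> real" and U :: "nat filter"
  assumes duals: "\<And>n. dual_copy (Vs n) (Vs (Suc n)) (Ts n)" and ultra: "ultra U"
begin

lemmas T_diff = dual_copyD(3)[OF duals]
lemmas T_le = dual_copyD(4)[OF duals]
lemmas subspace = dual_copyD(1)[OF duals]

lemma norming_functional:
  assumes "v \<in> Vs 0"
  obtains w where "w \<in> Vs 1" "norm w \<le> 1" "Ts 0 w v = norm v"
proof -
  obtain h where h: "linear h" "\<And>x. h x \<le> norm x" "h v = norm v"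
    using hahn_banach[OF sublinear_norm] by blast
  obtain w where "w \<in> Vs (Suc 0)" "\<forall>v\<in>Vs 0. Ts 0 w v = h v" "norm w \<le> 1"
  proof (rule dual_copy_represents[OF duals[of 0], of h 1])
    show "\<bar>h x\<bar> \<le> 1 * norm x" for x using bounded_linear_of_le_norm(2)[OF h(1,2)] by simp
  qed (auto simp: linear_add[OF h(1)] linear_cmul[OF h(1)])
  with assms h(3) show ?thesis using that by simp
qed

text \<open>The limit along \<open>U\<close> of a sequence in \<open>Vs m\<close>, taken in the
  bidual \<open>Vs (m + 2)\<close>. The choice asks for every norm bound at once, so that it does
  not depend on a particular \<open>B\<close>; the supremum of the norms shows that this can be
  met.\<close>

definition weak_star_lim :: "nat \<Rightarrow> (nat \<Rightarrow> 'u) \<Rightarrow> 'u" where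
  "weak_star_lim m v = (SOME w. w \<in> Vs (m + 2) \<and> (\<forall>B. (\<forall>n. norm (v n) \<le> B) \<longrightarrow> norm w \<le> B) \<and>
     (\<forall>u\<in>Vs (m + 1). ((\<lambda>n. Ts m u (v n)) \<longlongrightarrow> Ts (m + 1) w u) U))"

lemma weak_star_lim:
  assumes v: "\<And>n. v n \<in> Vs m" and B: "\<And>n. norm (v n) \<le> B"
  shows "weak_star_lim m v \<in> Vs (m + 2)" "norm (weak_star_lim m v) \<le> B"
    and "u \<in> Vs (m + 1) \<Longrightarrow> ((\<lambda>n. Ts m u (v n)) \<longlongrightarrow> Ts (m + 1) (weak_star_lim m v) u) U"
proof -
  define K where "K = (SUP n. norm (v n))"
  have bdd: "bdd_above (range (\<lambda>n. norm (v n)))" using B by (intro bdd_aboveI2)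
  have vK: "norm (v n) \<le> K" for n unfolding K_def by (rule cSUP_upper[OF _ bdd]) simp
  have K: "0 \<le> K" using vK[of 0] norm_ge_zero order_trans by blast
  have KB: "K \<le> B'" if "\<forall>n. norm (v n) \<le> B'" for B'
    unfolding K_def using that by (intro cSUP_least) auto
  define f where "f u = Lim U (\<lambda>n. Ts m u (v n))" for u
  have Tb: "\<bar>Ts m u (v n)\<bar> \<le> K * norm u" if "u \<in> Vs (Suc m)" for u n
    using T_le[OF that v[of n]] mult_left_mono[OF vK[of n] norm_ge_zero[of u]] by (simp add: mult.commute)
  have f: "((\<lambda>n. Ts m u (v n)) \<longlongrightarrow> f u) U" if "u \<in> Vs (Suc m)" for u
    unfolding f_def by (rule ultra_tendsto_Lim[OF ultra always_eventually]) (use Tb[OF that] in blast)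
  note D = duals[of m, unfolded dual_copy_def]
  have "\<exists>w. w \<in> Vs (m + 2) \<and> (\<forall>B. (\<forall>n. norm (v n) \<le> B) \<longrightarrow> norm w \<le> B) \<and>
     (\<forall>u\<in>Vs (m + 1). ((\<lambda>n. Ts m u (v n)) \<longlongrightarrow> Ts (m + 1) w u) U)"
  proof -
    obtain w where w: "w \<in> Vs (Suc (Suc m))" "\<forall>u\<in>Vs (Suc m). Ts (Suc m) w u = f u" "norm w \<le> K"
    proof (rule dual_copy_represents[OF duals[of "Suc m"], of f K])
      show "f (u + u') = f u + f u'" if "u \<in> Vs (Suc m)" "u' \<in> Vs (Suc m)" for u u'
      proof (rule tendsto_unique[OF ultra_not_bot[OF ultra]])
        show "((\<lambda>n. Ts m (u + u') (v n)) \<longlongrightarrow> f (u + u')) U"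
          using that by (intro f subspace_add[OF subspace])
        have "Ts m (u + u') (v n) = Ts m u (v n) + Ts m u' (v n)" for n using D that v by blast
        then show "((\<lambda>n. Ts m (u + u') (v n)) \<longlongrightarrow> f u + f u') U"
          using tendsto_add[OF f[OF that(1)] f[OF that(2)]] by simp
      qed
      show "f (r *\<^sub>R u) = r * f u" if "u \<in> Vs (Suc m)" for r u
      proof (rule tendsto_unique[OF ultra_not_bot[OF ultra]])
        show "((\<lambda>n. Ts m (r *\<^sub>R u) (v n)) \<longlongrightarrow> f (r *\<^sub>R u)) U"
          using that by (intro f subspace_scale[OF subspace])
        have "Ts m (r *\<^sub>R u) (v n) = r * Ts m u (v n)" for n using D that v by blast
        then show "((\<lambda>n. Ts m (r *\<^sub>R u) (v n)) \<longlongrightarrow> r * f u) U"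
          using tendsto_mult_left[OF f[OF that]] by simp
      qed
      show "\<bar>f u\<bar> \<le> K * norm u" if "u \<in> Vs (Suc m)" for u
        by (rule tendsto_upperbound[OF tendsto_rabs[OF f[OF that]]])
           (use Tb[OF that] ultra_not_bot[OF ultra] in auto)
    qed (use K in auto)
    have "norm w \<le> B'" if "\<forall>n. norm (v n) \<le> B'" for B' using KB[OF that] w(3) by simp
    with w f show ?thesis by (intro exI[of _ w]) auto
  qed
  then have *: "weak_star_lim m v \<in> Vs (m + 2) \<and> (\<forall>B. (\<forall>n. norm (v n) \<le> B) \<longrightarrow> norm (weak_star_lim m v) \<le> B) \<and>
     (\<forall>u\<in>Vs (m + 1). ((\<lambda>n. Ts m u (v n)) \<longlongrightarrow> Ts (m + 1) (weak_star_lim m v) u) U)"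
    unfolding weak_star_lim_def by (rule someI_ex)
  then show "weak_star_lim m v \<in> Vs (m + 2)" "norm (weak_star_lim m v) \<le> B"
    "u \<in> Vs (m + 1) \<Longrightarrow> ((\<lambda>n. Ts m u (v n)) \<longlongrightarrow> Ts (m + 1) (weak_star_lim m v) u) U"
    using B by blast+
qed

text \<open>The limit over the first index is the outermost one. The \<open>k\<close> inner limits
  have already raised the order to \<open>m + 2 * k\<close>.\<close>

primrec iter_lim :: "nat \<Rightarrow> nat \<Rightarrow> (nat list \<Rightarrow> 'u) \<Rightarrow> 'u" where
  "iter_lim m 0 h = h []"
| "iter_lim m (Suc k) h = weak_star_lim (m + 2 * k) (\<lambda>n. iter_lim m k (\<lambda>ps. h (n # ps)))"

definition bdd_on :: "nat \<Rightarrow> real \<Rightarrow> nat \<Rightarrow> (nat list \<Rightarrow> 'u) \<Rightarrow> bool" where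
  "bdd_on m B k h \<longleftrightarrow> (\<forall>ps. length ps = k \<longrightarrow> h ps \<in> Vs m \<and> norm (h ps) \<le> B)"

lemma bdd_on_Cons: "bdd_on m B (Suc k) h \<Longrightarrow> bdd_on m B k (\<lambda>ps. h (n # ps))"
  by (simp add: bdd_on_def)

lemma iter_lim_bounded:
  "bdd_on m B k h \<Longrightarrow> iter_lim m k h \<in> Vs (m + 2 * k) \<and> norm (iter_lim m k h) \<le> B"
proof (induction k arbitrary: h)
  case 0
  then show ?case by (simp add: bdd_on_def)
next
  case (Suc k)
  note IH = Suc.IH[OF bdd_on_Cons[OF Suc.prems]]
  show ?case
    using weak_star_lim(1,2)[of "\<lambda>n. iter_lim m k (\<lambda>ps. h (n # ps))" "m + 2 * k" B] IH by simp
qed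

lemma iter_lim_tendsto:
  assumes "bdd_on m B (Suc k) h" "u \<in> Vs (m + 2 * k + 1)"
  shows "((\<lambda>n. Ts (m + 2 * k) u (iter_lim m k (\<lambda>ps. h (n # ps)))) \<longlongrightarrow>
    Ts (m + 2 * k + 1) (iter_lim m (Suc k) h) u) U"
  using weak_star_lim(3)[of "\<lambda>n. iter_lim m k (\<lambda>ps. h (n # ps))" "m + 2 * k" B u]
    iter_lim_bounded[OF bdd_on_Cons[OF assms(1)]] assms(2) by simp

end

text \<open>The k-fold iterate of \<open>pair_filter\<close> with the pairs unzipped into two lists;
  the quantifiers run in the order p, q, p, q and so on.\<close>

primrec ev_interlaced :: "nat filter \<Rightarrow> nat \<Rightarrow> (nat list \<Rightarrow> nat list \<Rightarrow> bool) \<Rightarrow> bool" where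
  "ev_interlaced U 0 P \<longleftrightarrow> P [] []"
| "ev_interlaced U (Suc k) P \<longleftrightarrow>
     (\<forall>\<^sub>F p in U. \<forall>\<^sub>F q in U. ev_interlaced U k (\<lambda>ps qs. P (p # ps) (q # qs)))"

lemma ev_interlaced_mono:
  "ev_interlaced U k P \<Longrightarrow> (\<And>ps qs. length ps = k \<Longrightarrow> length qs = k \<Longrightarrow> P ps qs \<Longrightarrow> Q ps qs) \<Longrightarrow>
    ev_interlaced U k Q"
proof (induction k arbitrary: P Q)
  case (Suc k)
  have "ev_interlaced U k (\<lambda>ps qs. Q (p # ps) (q # qs))"
    if "ev_interlaced U k (\<lambda>ps qs. P (p # ps) (q # qs))" for p q
    by (rule Suc.IH[OF that]) (simp add: Suc.prems(2))
  then show ?case using Suc.prems(1) by (auto elim!: eventually_mono)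
qed simp

lemma ev_interlaced_conj:
  "ev_interlaced U k P \<Longrightarrow> ev_interlaced U k Q \<Longrightarrow> ev_interlaced U k (\<lambda>ps qs. P ps qs \<and> Q ps qs)"
proof (induction k arbitrary: P Q)
  case (Suc k)
  from Suc.prems have "\<forall>\<^sub>F p in U. (\<forall>\<^sub>F q in U. ev_interlaced U k (\<lambda>ps qs. P (p # ps) (q # qs))) \<and>
      (\<forall>\<^sub>F q in U. ev_interlaced U k (\<lambda>ps qs. Q (p # ps) (q # qs)))"
    by (simp add: eventually_conj)
  then have "\<forall>\<^sub>F p in U. \<forall>\<^sub>F q in U. ev_interlaced U k (\<lambda>ps qs. P (p # ps) (q # qs)) \<and>
      ev_interlaced U k (\<lambda>ps qs. Q (p # ps) (q # qs))"
    by (simp add: eventually_conj_iff)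
  then show ?case by (auto elim!: eventually_mono intro: Suc.IH)
qed simp

lemma ev_interlaced_all:
  assumes "eventually A U"
  shows "ev_interlaced U k (\<lambda>ps qs. \<forall>p\<in>set ps. A p)"
proof (induction k)
  case (Suc k)
  have "ev_interlaced U k (\<lambda>ps qs. \<forall>p\<in>set (p # ps). A p)" if "A p" for p
    by (rule ev_interlaced_mono[OF Suc.IH]) (use that in auto)
  then show ?case using assms by (auto elim!: eventually_mono)
qed simp

text \<open>A strict bound on an iterated limit unfolds into eventual bounds, one pair at a time,
  while \<open>u\<close> accumulates the differences already fixed.\<close>

lemma ev_interlaced_differences:
  fixes x :: "nat \<Rightarrow> 'a::real_normed_vector"
  assumes U: "ultra U" and bdd: "\<And>n. norm (x n) \<le> R"
  shows "asym_norm (pair_filter U) (\<lambda>(p, q). x p - x q) k (\<lambda>_. 1) u < c \<Longrightarrow>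
    ev_interlaced U k (\<lambda>ps qs. norm (u + (sum_list (map x ps) - sum_list (map x qs))) < c)"
proof (induction k arbitrary: u)
  case (Suc k)
  have "norm (x p - x q) \<le> R + R" for p q
    using norm_triangle_ineq4[of "x p" "x q"] bdd[of p] bdd[of q] by simp
  then interpret bounded_along "pair_filter U" "\<lambda>(p, q). x p - x q" "R + R"
    by unfold_locales (auto intro!: ultra_pair_filter U always_eventually)
  have "\<forall>\<^sub>F i in pair_filter U. nrm k (\<lambda>_. 1) (u + 1 *\<^sub>R (case i of (p, q) \<Rightarrow> x p - x q)) < c"
    using order_tendstoD(2)[OF nrm_tendsto Suc.prems] .
  then have "\<forall>\<^sub>F p in U. \<forall>\<^sub>F q in U. nrm k (\<lambda>_. 1) (u + (x p - x q)) < c"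
    by (simp add: eventually_pair_filter)
  then have "\<forall>\<^sub>F p in U. \<forall>\<^sub>F q in U. ev_interlaced U k (\<lambda>ps qs.
      norm ((u + (x p - x q)) + (sum_list (map x ps) - sum_list (map x qs))) < c)"
    by (auto elim!: eventually_mono intro: Suc.IH)
  then show ?case by (simp add: algebra_simps)
qed simp

text \<open>Each of the \<open>2 k\<close> limits moves the pairing one step up the tower of duals.\<close>
lemma (in dual_tower) iterated_pairing:
  assumes "bdd_on 0 B k h" "bdd_on 0 B' k h'" "bdd_on 1 C k g"
    and "ev_interlaced U k (\<lambda>ps qs. c \<le> Ts 0 (g ps) (h qs - h' qs))"
  shows "c \<le> Ts (2 * k) (iter_lim 1 k g) (iter_lim 0 k h - iter_lim 0 k h')"
  using assms
proof (induction k arbitrary: g h h')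
  case (Suc k)
  define H where "H q = iter_lim 0 k (\<lambda>ps. h (q # ps))" for q
  define H' where "H' q = iter_lim 0 k (\<lambda>ps. h' (q # ps))" for q
  define G where "G p = iter_lim 1 k (\<lambda>ps. g (p # ps))" for p
  have H: "H q \<in> Vs (2 * k)" and H': "H' q \<in> Vs (2 * k)" and G: "G q \<in> Vs (Suc (2 * k))" for q
    using iter_lim_bounded[OF bdd_on_Cons[OF Suc.prems(1)]] iter_lim_bounded[OF bdd_on_Cons[OF Suc.prems(2)]]
      iter_lim_bounded[OF bdd_on_Cons[OF Suc.prems(3)]] by (auto simp: H_def H'_def G_def)
  define w w' z where "w = iter_lim 0 (Suc k) h" and "w' = iter_lim 0 (Suc k) h'" and "z = iter_lim 1 (Suc k) g"
  have w: "w \<in> Vs (Suc (Suc (2 * k)))" "w' \<in> Vs (Suc (Suc (2 * k)))" "z \<in> Vs (Suc (Suc (Suc (2 * k))))"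
    using iter_lim_bounded[OF Suc.prems(1)] iter_lim_bounded[OF Suc.prems(2)] iter_lim_bounded[OF Suc.prems(3)]
    by (auto simp: w_def w'_def z_def simp del: iter_lim.simps)
  have limH: "((\<lambda>q. Ts (2 * k) u (H q)) \<longlongrightarrow> Ts (Suc (2 * k)) w u) U" if "u \<in> Vs (Suc (2 * k))" for u
    using iter_lim_tendsto[OF Suc.prems(1), of u] that by (simp add: H_def w_def del: iter_lim.simps)
  have limH': "((\<lambda>q. Ts (2 * k) u (H' q)) \<longlongrightarrow> Ts (Suc (2 * k)) w' u) U" if "u \<in> Vs (Suc (2 * k))" for u
    using iter_lim_tendsto[OF Suc.prems(2), of u] that by (simp add: H'_def w'_def del: iter_lim.simps)
  have limG: "((\<lambda>p. Ts (Suc (2 * k)) u (G p)) \<longlongrightarrow> Ts (Suc (Suc (2 * k))) z u) U" if "u \<in> Vs (Suc (Suc (2 * k)))" for u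
    using iter_lim_tendsto[OF Suc.prems(3), of u] that by (simp add: G_def z_def del: iter_lim.simps)
  have "\<forall>\<^sub>F p in U. \<forall>\<^sub>F q in U. c \<le> Ts (2 * k) (G p) (H q - H' q)"
    using Suc.prems(4) unfolding ev_interlaced.simps H_def H'_def G_def
    by (elim eventually_mono) (intro Suc.IH bdd_on_Cons Suc.prems(1-3))
  \<comment> \<open>First \<open>q\<close> moves with \<open>p\<close> fixed, which replaces
    \<open>H q\<close> by \<open>w\<close> and lets the vector act on the functional; afterwards
    \<open>p\<close> moves. The difference is split because the limits are known for
    \<open>H\<close> and \<open>H'\<close> separately.\<close>
  then have "\<forall>\<^sub>F p in U. c \<le> Ts (Suc (2 * k)) w (G p) - Ts (Suc (2 * k)) w' (G p)"
  proof eventually_elim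
    fix p assume "\<forall>\<^sub>F q in U. c \<le> Ts (2 * k) (G p) (H q - H' q)"
    then have "\<forall>\<^sub>F q in U. c \<le> Ts (2 * k) (G p) (H q) - Ts (2 * k) (G p) (H' q)"
      by (simp add: T_diff G H H')
    then show "c \<le> Ts (Suc (2 * k)) w (G p) - Ts (Suc (2 * k)) w' (G p)"
      by (intro tendsto_lowerbound[OF tendsto_diff[OF limH[OF G] limH'[OF G]]] ultra_not_bot[OF ultra])
  qed
  then have "c \<le> Ts (Suc (Suc (2 * k))) z w - Ts (Suc (Suc (2 * k))) z w'"
    by (intro tendsto_lowerbound[OF tendsto_diff[OF limG[OF w(1)] limG[OF w(2)]]] ultra_not_bot[OF ultra])
  then show ?case
    using w by (simp add: T_diff w_def w'_def z_def del: iter_lim.simps)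
qed simp

subsection \<open>The coarse embedding\<close>

lemma sum_list_ge:
  fixes g :: "'b \<Rightarrow> real"
  shows "(\<And>p. p \<in> set ps \<Longrightarrow> c \<le> g p) \<Longrightarrow> real (length ps) * c \<le> sum_list (map g ps)"
  by (induction ps) (fastforce simp: algebra_simps)+

lemma norm_sum_list_map_le:
  fixes x :: "'b \<Rightarrow> 'a::real_normed_vector"
  assumes "\<And>p. norm (x p) \<le> R"
  shows "norm (sum_list (map x ps)) \<le> real (length ps) * R"
proof (induction ps)
  case (Cons p ps)
  have "norm (x p + sum_list (map x ps)) \<le> norm (x p) + norm (sum_list (map x ps))"
    by (rule norm_triangle_ineq)
  with Cons assms[of p] show ?case by (simp add: algebra_simps)
qed simp

lemma blinfun_sum_list_map: "blinfun_apply h (sum_list (map x ps)) = sum_list (map (\<lambda>p. blinfun_apply h (x p)) ps)"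
  by (induction ps) (auto simp: blinfun.zero_right blinfun.add_right)

lemma blinfun_norm_gt:
  fixes z :: "'v::real_normed_vector \<Rightarrow>\<^sub>L real"
  assumes "c < norm z" "0 \<le> c"
  obtains v where "norm v \<le> 1" "c < blinfun_apply z v"
proof -
  obtain v where v: "c * norm v < \<bar>z v\<bar>"
    using norm_blinfun_bound[of c z] assms by (metis not_le real_norm_def)
  then have nz: "v \<noteq> 0" by (auto simp: blinfun.zero_right)
  define u where "u = (sgn (z v) / norm v) *\<^sub>R v"
  have "z u = \<bar>z v\<bar> / norm v" by (simp add: u_def blinfun.scaleR_right abs_sgn mult.commute)
  then have "c < z u" using v nz by (simp add: pos_less_divide_eq)
  moreover have "norm u \<le> 1" using nz by (simp add: u_def sgn_if)
  ultimately show ?thesis using that by blast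
qed

theorem theorem5p8:
  fixes f :: "'a::banach \<Rightarrow> 'b::banach"
    and Vs :: "nat \<Rightarrow> 'u::real_normed_vector set"
    and Ts :: "nat \<Rightarrow> 'u \<Rightarrow> 'u \<Rightarrow> real"
  assumes X_sep: "separable_space (euclidean :: 'a topology)"
    and X_bidual_nonsep: "\<not> separable_space (euclidean :: (('a \<Rightarrow>\<^sub>L real) \<Rightarrow>\<^sub>L real) topology)"
    and no_l1: "\<not> l1_embeds_into TYPE('a)"
    and no_l1_sm: "\<And>(x :: nat \<Rightarrow> 'a) N. (\<forall>n. norm (x n) = 1) \<Longrightarrow> weakly_null x \<Longrightarrow>
                      generates_spreading_model x N \<Longrightarrow> \<not> sm_equiv_l1 N"
    and coarse: "coarse_embedding f"
    and duals: "iterated_duals TYPE('b) Vs Ts"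
  shows "\<exists>k::nat. \<not> separable_space (subtopology euclidean (Vs (2 * k)))"
proof (rule ccontr)
  assume "\<not> ?thesis"
  then have sepV: "separable_in (Vs (2 * k))" for k by (auto intro: separable_in_if_separable_space)
  have "separable_in (UNIV :: 'a set)" using X_sep by (intro separable_in_if_separable_space) simp
  then obtain d :: "nat \<Rightarrow> 'a" where d: "\<And>x e. 0 < e \<Longrightarrow> \<exists>n. norm (x - d n) < e"
    unfolding separable_in_def by blast
  obtain U :: "nat filter" where U: "ultra U" "U \<le> sequentially"
    by (rule ultra_exists[of "sequentially :: nat filter"]) auto
  obtain J :: "'b \<Rightarrow> 'u" where J: "linear J" "\<And>y. norm (J y) = norm y" "range J = Vs 0"
    using duals unfolding iterated_duals_def isometric_copy_def by blast
  interpret dual_tower Vs Ts U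
    using duals U(1) by unfold_locales (auto simp: iterated_duals_def)
  obtain \<rho> \<omega> :: "real \<Rightarrow> real" where mono: "mono_on {0..} \<rho>" "mono_on {0..} \<omega>"
    and \<omega>0: "\<And>t. 0 \<le> t \<Longrightarrow> 0 \<le> \<omega> t"
    and \<rho>: "filterlim \<rho> at_top at_top"
    and f: "\<And>x y. \<rho> (norm (x - y)) \<le> norm (f x - f y)" "\<And>x y. norm (f x - f y) \<le> \<omega> (norm (x - y))"
    using coarse unfolding coarse_embedding_def by blast
  \<comment> \<open>Exchanging \<open>p\<close> for \<open>q\<close> in two images costs
    \<open>2 * \<omega> 1\<close>; the remaining 2 exceeds the distance 1 left between the
    limits.\<close>
  obtain R where R: "0 < R" "2 * \<omega> 1 + 2 \<le> \<rho> R"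
  proof -
    have "eventually (\<lambda>t. 0 < t \<and> 2 * \<omega> 1 + 2 \<le> \<rho> t) at_top"
      using \<rho> by (intro eventually_conj eventually_gt_at_top) (simp add: filterlim_at_top)
    then show thesis using that eventually_happens'[OF trivial_limit_at_top_linorder] by blast
  qed
  have "\<not> separable_in (seq_limits :: (('a \<Rightarrow>\<^sub>L real) \<Rightarrow>\<^sub>L real) set)"
    using X_bidual_nonsep separable_space_if_separable_in
    by (intro seq_limits_not_separable[OF U no_l1]) blast
  then obtain \<theta> and I :: "(('a \<Rightarrow>\<^sub>L real) \<Rightarrow>\<^sub>L real) set" where \<theta>: "0 < \<theta>"
    and I: "I \<subseteq> seq_limits" "uncountable I"
      "\<forall>z\<in>I. \<forall>z'\<in>I. z \<noteq> z' \<longrightarrow> \<theta> \<le> norm (z - z')"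
    by (rule not_separable_in_separated) blast
  \<comment> \<open>Then vectors that differ by \<open>k * (\<theta> / 2)\<close> are at distance
    \<open>\<theta> / (2 * e) = R\<close> after division by \<open>e * k\<close>.\<close>
  define e where "e = \<theta> / (2 * R)"
  have e: "0 < e" using \<theta> R by (simp add: e_def)
  have "\<exists>x B k. (\<forall>n. norm (x n) \<le> B) \<and> (\<forall>h. (\<lambda>n. blinfun_apply h (x n)) \<longlonglongrightarrow> blinfun_apply z h) \<and> 0 < k \<and>
      asym_norm (pair_filter U) (\<lambda>(p, q). x p - x q) k (\<lambda>_. 1) 0 < e * real k" if zI: "z \<in> I" for z
  proof -
    obtain x :: "nat \<Rightarrow> 'a" and B where x: "\<forall>n. norm (x n) \<le> B" "\<forall>h. (\<lambda>n. blinfun_apply h (x n)) \<longlonglongrightarrow> blinfun_apply z h"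
      using I(1) zI unfolding seq_limits_def by blast
    have wc: "weakly_Cauchy x" unfolding weakly_Cauchy_def convergent_def using x(2) by blast
    obtain k where "0 < k" "asym_norm (pair_filter U) (\<lambda>(p, q). x p - x q) k (\<lambda>_. 1) 0 < e * real k"
    proof (rule asym_norm_differences_small[OF d _ U x(1)[rule_format] wc e])
      show "\<not> sm_equiv_l1 N" if "\<forall>n. norm (y n) = 1" "weakly_null y" "generates_spreading_model y N"
        for y :: "nat \<Rightarrow> 'a" and N
        using that by (rule no_l1_sm)
    qed (assumption, rule that)
    with x show ?thesis by blast
  qed
  then obtain x B K where x: "\<And>z n. z \<in> I \<Longrightarrow> norm (x z n) \<le> B z"
    "\<And>z h. z \<in> I \<Longrightarrow> (\<lambda>n. blinfun_apply h (x z n)) \<longlonglongrightarrow> blinfun_apply z h"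
    and K: "\<And>z. z \<in> I \<Longrightarrow> (0::nat) < K z"
    "\<And>z. z \<in> I \<Longrightarrow> asym_norm (pair_filter U) (\<lambda>(p, q). x z p - x z q) (K z) (\<lambda>_. 1) 0 < e * real (K z)"
    by metis
  \<comment> \<open>\<open>K z\<close> takes countably many values on the uncountable
    \<open>I\<close>. A common \<open>k\<close> puts the limits into the same dual and makes the
    tuples comparable.\<close>
  obtain k where k: "uncountable {z \<in> I. K z = k}"
  proof (rule ccontr)
    assume "\<not> thesis"
    then have "countable {z \<in> I. K z = k}" for k using that by blast
    then have "countable (\<Union>k. {z \<in> I. K z = k})" by blast
    moreover have "(\<Union>k. {z \<in> I. K z = k}) = I" by blast
    ultimately show False using I(2) by simp
  qed
  define \<mu> where "\<mu> = 1 / (e * real k)"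
  define h where "h z ps = J (f (\<mu> *\<^sub>R sum_list (map (x z) ps)))" for z ps
  \<comment> \<open>A member of the class is needed to see \<open>0 < k\<close>; for
    \<open>k = 0\<close> the scale \<open>\<mu>\<close> would be 0.\<close>
  have "{z \<in> I. K z = k} \<noteq> {}"
  proof
    assume eq: "{z \<in> I. K z = k} = {}"
    show False using k unfolding eq by simp
  qed
  then obtain z0 where "z0 \<in> I" "K z0 = k" by blast
  then have k0: "0 < k" using K(1)[of z0] by simp
  have \<mu>: "0 < \<mu>" "\<mu> * (e * real k) = 1" using e k0 by (simp_all add: \<mu>_def)
  have h_diff: "norm (h z ps - h z' qs) = norm (f (\<mu> *\<^sub>R sum_list (map (x z) ps)) - f (\<mu> *\<^sub>R sum_list (map (x z') qs)))" for z z' ps qs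
    unfolding h_def using linear_diff[OF J(1)] J(2) by metis
  have hV: "h z ps \<in> Vs 0" for z ps using J(3) by (auto simp: h_def)
  have h_bdd: "\<exists>C. bdd_on 0 C k (h z)" if z: "z \<in> I" for z
  proof -
    have B0: "0 \<le> B z" using x(1)[OF z, of 0] norm_ge_zero order_trans by blast
    have "norm (h z ps) \<le> norm (f 0) + \<omega> (\<mu> * (real k * B z))" if "length ps = k" for ps
    proof -
      define v where "v = \<mu> *\<^sub>R sum_list (map (x z) ps)"
      have "norm v \<le> \<mu> * (real k * B z)"
        using norm_sum_list_map_le[of "x z" "B z" ps, OF x(1)[OF z]] that \<mu>(1) by (simp add: v_def)
      then have "\<omega> (norm v) \<le> \<omega> (\<mu> * (real k * B z))"
        using \<mu>(1) B0 by (intro mono_onD[OF mono(2)]) auto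
      moreover have "norm (f v) \<le> norm (f 0) + norm (f v - f 0)"
        using norm_triangle_ineq[of "f 0" "f v - f 0"] by simp
      ultimately show ?thesis using f(2)[of v 0] by (simp add: h_def J(2) v_def)
    qed
    then show ?thesis unfolding bdd_on_def using hV by blast
  qed
  have "iter_lim 0 k (h z) \<in> Vs (2 * k)" if z: "z \<in> I" for z
  proof -
    obtain C where "bdd_on 0 C k (h z)" using h_bdd[OF z] ..
    from iter_lim_bounded[OF this] show ?thesis by simp
  qed
  then have lim_in: "(\<lambda>z. iter_lim 0 k (h z)) ` {z \<in> I. K z = k} \<subseteq> Vs (2 * k)" by blast
  obtain z z' where z: "z \<in> I" "K z = k" and z': "z' \<in> I" "K z' = k" and "z \<noteq> z'"
    and close: "norm (iter_lim 0 k (h z) - iter_lim 0 k (h z')) < 1"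
    by (rule separable_in_close_pair[OF sepV k lim_in zero_less_one]) (rule that, auto)
  \<comment> \<open>A bidual norm is only approached on the unit ball, so half of the separation is
    given up to obtain an actual functional.\<close>
  have "\<theta> / 2 < norm (z - z')" using I(3) z z' \<open>z \<noteq> z'\<close> \<theta> by fastforce
  then obtain \<phi> where \<phi>: "norm \<phi> \<le> 1" "\<theta> / 2 < blinfun_apply (z - z') \<phi>"
    by (rule blinfun_norm_gt) (use \<theta> in auto)
  have "(\<lambda>n. blinfun_apply \<phi> (x z n) - blinfun_apply \<phi> (x z' n)) \<longlonglongrightarrow> blinfun_apply z \<phi> - blinfun_apply z' \<phi>"
    by (intro tendsto_diff x(2) z(1) z'(1))
  then have "\<forall>\<^sub>F n in sequentially. \<theta> / 2 < blinfun_apply \<phi> (x z n) - blinfun_apply \<phi> (x z' n)"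
    using \<phi>(2) by (intro order_tendstoD(1)) (auto simp: blinfun.diff_left)
  then have "\<forall>\<^sub>F n in U. \<theta> / 2 < blinfun_apply \<phi> (x z n) - blinfun_apply \<phi> (x z' n)"
    using U(2) filter_leD by blast
  then have far: "ev_interlaced U k (\<lambda>ps qs. \<forall>p\<in>set ps. \<theta> / 2 < blinfun_apply \<phi> (x z p) - blinfun_apply \<phi> (x z' p))"
    by (rule ev_interlaced_all)
  have near: "ev_interlaced U k (\<lambda>ps qs. norm (h z ps - h z qs) \<le> \<omega> 1)" if z: "z \<in> I" "K z = k" for z
  proof (rule ev_interlaced_mono)
    show "ev_interlaced U k (\<lambda>ps qs. norm (0 + (sum_list (map (x z) ps) - sum_list (map (x z) qs))) < e * real k)"
      using ev_interlaced_differences[OF U(1) x(1)[OF z(1)] K(2)[OF z(1)]] z(2) by simp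
    fix ps qs assume lt: "norm (0 + (sum_list (map (x z) ps) - sum_list (map (x z) qs))) < e * real k"
    have "norm (\<mu> *\<^sub>R sum_list (map (x z) ps) - \<mu> *\<^sub>R sum_list (map (x z) qs))
        = \<mu> * norm (sum_list (map (x z) ps) - sum_list (map (x z) qs))"
      using \<mu>(1) by (simp add: scaleR_diff_right[symmetric])
    also have "\<dots> \<le> \<mu> * (e * real k)" using lt \<mu>(1) by (intro mult_left_mono) auto
    finally have "\<omega> (norm (\<mu> *\<^sub>R sum_list (map (x z) ps) - \<mu> *\<^sub>R sum_list (map (x z) qs))) \<le> \<omega> 1"
      using \<mu>(2) by (intro mono_onD[OF mono(2)]) auto
    then show "norm (h z ps - h z qs) \<le> \<omega> 1" unfolding h_diff using f(2) by (rule order_trans[rotated])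
  qed
  \<comment> \<open>The norming functional is chosen from \<open>ps\<close> alone, as the iterated
    pairing requires.\<close>
  have "\<exists>w. w \<in> Vs 1 \<and> norm w \<le> 1 \<and> Ts 0 w (h z ps - h z' ps) = norm (h z ps - h z' ps)" for ps
    using norming_functional[OF subspace_diff[OF subspace hV hV]] by metis
  then obtain g where g: "\<And>ps. g ps \<in> Vs 1" "\<And>ps. norm (g ps) \<le> 1"
    "\<And>ps. Ts 0 (g ps) (h z ps - h z' ps) = norm (h z ps - h z' ps)" by metis
  have g_bdd: "bdd_on 1 1 k g" using g by (simp add: bdd_on_def)
  have "ev_interlaced U k (\<lambda>ps qs. \<rho> R - 2 * \<omega> 1 \<le> Ts 0 (g ps) (h z qs - h z' qs))"
  proof (rule ev_interlaced_mono[OF ev_interlaced_conj[OF far ev_interlaced_conj[OF near[OF z] near[OF z']]]])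
    fix ps qs :: "nat list"
    assume len: "length ps = k" and *: "(\<forall>p\<in>set ps. \<theta> / 2 < blinfun_apply \<phi> (x z p) - blinfun_apply \<phi> (x z' p)) \<and>
      norm (h z ps - h z qs) \<le> \<omega> 1 \<and> norm (h z' ps - h z' qs) \<le> \<omega> 1"
    define a where "a = \<mu> *\<^sub>R sum_list (map (x z) ps)"
    define a' where "a' = \<mu> *\<^sub>R sum_list (map (x z') ps)"
    have "R = \<mu> * (real k * (\<theta> / 2))" using e k0 R \<theta> by (simp add: \<mu>_def e_def field_simps)
    also have "\<dots> \<le> \<mu> * sum_list (map (\<lambda>p. blinfun_apply \<phi> (x z p) - blinfun_apply \<phi> (x z' p)) ps)"
      using sum_list_ge[of ps "\<theta> / 2" "\<lambda>p. blinfun_apply \<phi> (x z p) - blinfun_apply \<phi> (x z' p)"] * \<mu>(1) len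
      by (intro mult_left_mono) (auto intro: less_imp_le)
    also have "\<dots> = blinfun_apply \<phi> (a - a')"
      by (simp add: a_def a'_def blinfun.diff_right blinfun.scaleR_right blinfun_sum_list_map
          sum_list_subtractf right_diff_distrib)
    also have "\<dots> \<le> norm (a - a')"
      using norm_blinfun[of \<phi> "a - a'"] mult_right_mono[OF \<phi>(1) norm_ge_zero[of "a - a'"]] by simp
    finally have "\<rho> R \<le> \<rho> (norm (a - a'))" using R(1) by (intro mono_onD[OF mono(1)]) auto
    also have "\<dots> \<le> norm (h z ps - h z' ps)" unfolding h_diff a_def a'_def by (rule f(1))
    finally have 1: "\<rho> R \<le> norm (h z ps - h z' ps)" .
    \<comment> \<open>The change in the difference of the two images when \<open>ps\<close> is
      replaced by \<open>qs\<close>. Regrouped by image, it is at most twice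
      \<open>\<omega> 1\<close>.\<close>
    define v where "v = h z ps - h z' ps - (h z qs - h z' qs)"
    have D: "h z ps - h z' ps \<in> Vs 0" "h z qs - h z' qs \<in> Vs 0"
      by (intro subspace_diff[OF subspace] hV)+
    then have v: "v \<in> Vs 0" unfolding v_def by (rule subspace_diff[OF subspace])
    have gS: "g ps \<in> Vs (Suc 0)" using g(1) by simp
    have "v = (h z ps - h z qs) - (h z' ps - h z' qs)" by (simp add: v_def)
    then have "norm v \<le> norm (h z ps - h z qs) + norm (h z' ps - h z' qs)"
      using norm_triangle_ineq4 by metis
    then have "norm v \<le> 2 * \<omega> 1" using * by linarith
    moreover have "\<bar>Ts 0 (g ps) v\<bar> \<le> norm v"
      using T_le[OF gS v] mult_right_mono[OF g(2)[of ps] norm_ge_zero[of v]] by simp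
    moreover have "Ts 0 (g ps) v = norm (h z ps - h z' ps) - Ts 0 (g ps) (h z qs - h z' qs)"
      unfolding v_def using T_diff[OF gS D] g(3) by simp
    ultimately show "\<rho> R - 2 * \<omega> 1 \<le> Ts 0 (g ps) (h z qs - h z' qs)" using 1 by linarith
  qed
  moreover obtain C C' where hb: "bdd_on 0 C k (h z)" "bdd_on 0 C' k (h z')"
    using h_bdd z(1) z'(1) by blast
  ultimately have "\<rho> R - 2 * \<omega> 1 \<le> Ts (2 * k) (iter_lim 1 k g) (iter_lim 0 k (h z) - iter_lim 0 k (h z'))"
    using iterated_pairing g_bdd by blast
  also have "\<dots> \<le> norm (iter_lim 1 k g) * norm (iter_lim 0 k (h z) - iter_lim 0 k (h z'))"
  proof -
    have "iter_lim 1 k g \<in> Vs (Suc (2 * k))" using iter_lim_bounded[OF g_bdd] by simp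
    moreover have "iter_lim 0 k (h z) - iter_lim 0 k (h z') \<in> Vs (2 * k)"
      using lim_in z z' by (intro subspace_diff[OF subspace]) blast+
    ultimately show ?thesis using T_le by (meson abs_le_iff)
  qed
  also have "\<dots> \<le> 1 * 1"
    using iter_lim_bounded[OF g_bdd] close by (intro mult_mono) auto
  finally show False using R(2) by simp
qed

end
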